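(* The coordination capacity region for empirical coordination in the cascade network with source distribution $p_0(x)$ is $$\mathcal{C}_{p_0}=\{(R_1,R_2,p(y,z|x)) : R_1\ge I(X;Y,Z),\ R_2\ge I(X;Z)\},$$ where the mutual informations are computed under $(X,Y,Z)\sim p_0(x)p(y,z|x)$.
   Context: Alphabets $\mathcal{X},\mathcal{Y},\mathcal{Z}$ are finite; rates are nonnegative reals measured in bits (logarithms base 2); $\{1,\dots,2^{nR}\}$ denotes the set of integers $k$ with $1\le k\le 2^{nR}$. Cascade network: a $(2^{nR_1},2^{nR_2},n)$ coordination code consists of an encoding function $i:\mathcal{X}^n\to\{1,\dots,2^{nR_1}\}$, a recoding function $j:\{1,\dots,2^{nR_1}\}\to\{1,\dots,2^{nR_2}\}$, and two decoding functions $y^n:\{1,\dots,2^{nR_1}\}\to\mathcal{Y}^n$, $z^n:\{1,\dots,2^{nR_2}\}\to\mathcal{Z}^n$. The actions $X^n$ are i.i.d. according to $p_0(x)$, $Y^n=y^n(i(X^n))$, and $Z^n=z^n(j(i(X^n)))$. The joint type is $P_{x^n,y^n,z^n}(x,y,z)=\frac1n\sum_{i=1}^n\mathbf{1}((x_i,y_i,z_i)=(x,y,z))$. Total variation is $\|p-q\|_{TV}=\frac12\sum|p-q|$. The distribution $p_0(x)p(y,z|x)$ is achievable for empirical coordination at rates $(R_1,R_2)$ if there exists a sequence of $(2^{nR_1},2^{nR_2},n)$ coordination codes ($n=1,2,\dots$) such that $\|P_{X^n,Y^n,Z^n}-p_0(x)p(y,z|x)\|_{TV}\to0$ in probability. The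 coordination capacity region $\mathcal{C}_{p_0}$ is the closure of the set of tuples $(R_1,R_2,p(y,z|x))$ such that $p_0(x)p(y,z|x)$ is achievable at rates $(R_1,R_2)$. *)

theory Defs
  imports "HOL-Probability.Probability"
begin

text \<open>
  Block length \<open>n\<close> sequences over an alphabet \<open>'a\<close> are extensional functions
  on \<open>{..<n}\<close>, so position \<open>k + 1\<close> of the sequence is its value at \<open>k\<close>.
\<close>

definition blocks :: "nat \<Rightarrow> (nat \<Rightarrow> 'a) set" where
  "blocks n = {..<n} \<rightarrow>\<^sub>E UNIV"

definition iid_pmf :: "nat \<Rightarrow> 'a pmf \<Rightarrow> (nat \<Rightarrow> 'a) pmf" where
  "iid_pmf n p = Pi_pmf {..<n} undefined (\<lambda>_. p)"

definition messages :: "nat \<Rightarrow> real \<Rightarrow> nat set" where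
  "messages n R = {k. 1 \<le> k \<and> real k \<le> 2 powr (real n * R)}"

definition cascade_code ::
  "real \<Rightarrow> real \<Rightarrow> nat \<Rightarrow> ((nat \<Rightarrow> 'x) \<Rightarrow> nat) \<Rightarrow> (nat \<Rightarrow> nat) \<Rightarrow>
   (nat \<Rightarrow> nat \<Rightarrow> 'y) \<Rightarrow> (nat \<Rightarrow> nat \<Rightarrow> 'z) \<Rightarrow> bool" where
  "cascade_code R1 R2 n enc rec decy decz \<longleftrightarrow>
     enc \<in> blocks n \<rightarrow> messages n R1 \<and>
     rec \<in> messages n R1 \<rightarrow> messages n R2 \<and>
     decy \<in> messages n R1 \<rightarrow> blocks n \<and>
     decz \<in> messages n R2 \<rightarrow> blocks n"

definition joint_type ::
  "nat \<Rightarrow> (nat \<Rightarrow> 'x) \<Rightarrow> (nat \<Rightarrow> 'y) \<Rightarrow> (nat \<Rightarrow> 'z) \<Rightarrow> 'x \<times> 'y \<times> 'z \<Rightarrow> real" where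
  "joint_type n xs ys zs a = 1 / real n * (\<Sum>k<n. of_bool ((xs k, ys k, zs k) = a))"

definition total_variation :: "('a::finite \<Rightarrow> real) \<Rightarrow> ('a \<Rightarrow> real) \<Rightarrow> real" where
  "total_variation p q = 1 / 2 * (\<Sum>a\<in>UNIV. \<bar>p a - q a\<bar>)"

definition joint_pmf :: "'x pmf \<Rightarrow> ('x \<Rightarrow> ('y \<times> 'z) pmf) \<Rightarrow> ('x \<times> 'y \<times> 'z) pmf" where
  "joint_pmf p0 w = bind_pmf p0 (\<lambda>x. map_pmf (Pair x) (w x))"

lemma pmf_joint_pmf: "pmf (joint_pmf p0 w) (x, y, z) = pmf p0 x * pmf (w x) (y, z)"
proof -
  have "pmf (map_pmf (Pair x') (w x')) (x, y, z) = indicator {x} x' * pmf (w x) (y, z)" for x'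
  proof (cases "x' = x")
    case True
    have "pmf (map_pmf (Pair x) (w x)) (Pair x (y, z)) = pmf (w x) (y, z)"
      by (rule pmf_map_inj') (simp add: inj_def)
    with True show ?thesis by simp
  next
    case False
    then have "(x, y, z) \<notin> set_pmf (map_pmf (Pair x') (w x'))" by auto
    with False show ?thesis by (simp add: pmf_eq_0_set_pmf del: set_map_pmf)
  qed
  then show ?thesis
    by (simp add: joint_pmf_def pmf_bind measure_pmf_single)
qed

text \<open>
  The limit below is convergence in probability to \<open>0\<close> of the total variation
  distance; the underlying probability space (source sequences of length \<open>n\<close>)
  changes with \<open>n\<close>.
\<close>

definition achievable ::
  "'x::finite pmf \<Rightarrow> ('x \<Rightarrow> ('y::finite \<times> 'z::finite) pmf) \<Rightarrow> real \<Rightarrow> real \<Rightarrow> bool" where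
  "achievable p0 w R1 R2 \<longleftrightarrow>
     (\<exists>enc rec decy decz.
        (\<forall>n\<ge>1. cascade_code R1 R2 n (enc n) (rec n) (decy n) (decz n)) \<and>
        (\<forall>\<epsilon>>0. (\<lambda>n. measure_pmf.prob (iid_pmf n p0)
            {xs. total_variation
                   (joint_type n xs (decy n (enc n xs)) (decz n (rec n (enc n xs))))
                   (pmf (joint_pmf p0 w)) > \<epsilon>}) \<longlonglongrightarrow> 0))"

text \<open>
  Conditional distributions \<open>p(y,z|x)\<close> enter the region through their real-valued
  mass functions, so that the closure is taken in the product (Euclidean) topology
  of \<open>real \<times> real \<times> ('x \<Rightarrow> 'y \<times> 'z \<Rightarrow> real)\<close>.  Rates and mass functions
  range over a closed subset of this space.
\<close>

definition coordination_capacity_region ::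
  "'x::finite pmf \<Rightarrow> (real \<times> real \<times> ('x \<Rightarrow> 'y::finite \<times> 'z::finite \<Rightarrow> real)) set" where
  "coordination_capacity_region p0 =
     closure {(R1, R2, \<lambda>x. pmf (w x)) | R1 R2 w.
       0 \<le> R1 \<and> 0 \<le> R2 \<and> achievable p0 w R1 R2}"

definition mutual_info :: "'a pmf \<Rightarrow> ('a \<Rightarrow> 'b) \<Rightarrow> ('a \<Rightarrow> 'c) \<Rightarrow> real" where
  "mutual_info p X Y =
     prob_space.mutual_information (measure_pmf p) 2 (count_space UNIV) (count_space UNIV) X Y"

end

theory Submission imports Defs begin

text \<open>
  Both directions are changes of measure on typical sequences.

  Converse: for a fixed reconstruction \<open>b\<close>, the source sequences whose joint type with \<open>b\<close>
  is close to \<open>q\<close> have total probability at most about \<open>2 ^ (- n I(q))\<close>.  A code has at most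
  \<open>2 ^ (n R)\<close> reconstructions, so the union bound forces \<open>R \<ge> I(q)\<close>.

  Achievability: drawing a word from a product kernel, the probability that it is jointly typical
  with a given typical word is at least about \<open>2 ^ (- n D)\<close>, where \<open>D\<close> is the relative entropy
  of the desired kernel to the one used for drawing.  A greedy choice then covers all typical
  source words with about \<open>2 ^ (n D)\<close> codewords.  This is applied first to \<open>Z\<close>, and
  then, conditionally on each \<open>Z\<close>-codeword, to \<open>Y\<close>; the two exponents are
  \<open>I(X;Z)\<close> and \<open>I(X;Y|Z)\<close>.  Finally, the region is closed because mutual information is a
  continuous function of the channel.
\<close>

subsection \<open>Types and typical sequences\<close>

definition empirical :: "nat \<Rightarrow> (nat \<Rightarrow> 'a) \<Rightarrow> 'a \<Rightarrow> real" where
  "empirical n f a = (\<Sum>k<n. of_bool (f k = a)) / real n"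

text \<open>Closeness in the sup norm. The reference \<open>P\<close> is a real function rather than
  a pmf, so that an expression such as \<open>empirical n s a * pmf (V a) b\<close> can serve as
  reference.\<close>

definition typical :: "nat \<Rightarrow> ('a \<Rightarrow> real) \<Rightarrow> real \<Rightarrow> (nat \<Rightarrow> 'a) \<Rightarrow> bool" where
  "typical n P e f \<longleftrightarrow> (\<forall>a. \<bar>empirical n f a - P a\<bar> \<le> e)"

lemma joint_type_eq_empirical:
  "joint_type n xs ys zs = empirical n (\<lambda>k. (xs k, ys k, zs k))"
  by (rule ext) (simp add: joint_type_def empirical_def)

lemma sum_eq_empirical:
  fixes f :: "nat \<Rightarrow> 'a::finite" and g :: "'a \<Rightarrow> real"
  shows "(\<Sum>k<n. g (f k)) = real n * (\<Sum>a\<in>UNIV. empirical n f a * g a)"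
proof (cases "n = 0")
  case False
  have "(\<Sum>k<n. g (f k)) = (\<Sum>k<n. \<Sum>a\<in>UNIV. of_bool (f k = a) * g a)"
    by (intro sum.cong refl) (simp add: of_bool_def if_distrib[of "\<lambda>x. x * _"] cong: if_cong)
  also have "\<dots> = (\<Sum>a\<in>UNIV. (\<Sum>k<n. of_bool (f k = a)) * g a)"
    by (subst sum.swap) (simp add: sum_distrib_right)
  also have "\<dots> = (\<Sum>a\<in>UNIV. real n * (empirical n f a * g a))"
    using False by (simp add: empirical_def)
  finally show ?thesis by (simp add: sum_distrib_left)
qed simp

lemma empirical_comp:
  fixes f :: "nat \<Rightarrow> 'a::finite"
  shows "empirical n (\<lambda>k. h (f k)) c = (\<Sum>a\<in>h -` {c}. empirical n f a)"
proof -
  have "(\<Sum>k<n. of_bool (h (f k) = c)) = real n * (\<Sum>a\<in>UNIV. empirical n f a * of_bool (h a = c))"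
    using sum_eq_empirical[of "\<lambda>a. of_bool (h a = c)" f n] by simp
  moreover have "(\<Sum>a\<in>UNIV. empirical n f a * of_bool (h a = c)) = (\<Sum>a\<in>h -` {c}. empirical n f a)"
    by (intro sum.mono_neutral_cong_right) auto
  ultimately show ?thesis
    by (cases "n = 0") (simp_all add: empirical_def)
qed

text \<open>Typicality pins down the time average of every letter function \<open>g\<close>. It is
  applied with \<open>g\<close> a log-likelihood ratio, so that all typical words have nearly the
  same likelihood ratio.\<close>

lemma sum_typical_close:
  fixes f :: "nat \<Rightarrow> 'a::finite"
  assumes "typical n P e f"
  shows "\<bar>(\<Sum>k<n. g (f k)) - real n * (\<Sum>a\<in>UNIV. P a * g a)\<bar> \<le> real n * (e * (\<Sum>a\<in>UNIV. \<bar>g a\<bar>))"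
proof -
  have "(\<Sum>k<n. g (f k)) - real n * (\<Sum>a\<in>UNIV. P a * g a)
      = real n * (\<Sum>a\<in>UNIV. (empirical n f a - P a) * g a)"
    by (simp add: sum_eq_empirical sum_subtractf algebra_simps)
  also have "\<bar>\<dots>\<bar> \<le> real n * (\<Sum>a\<in>UNIV. \<bar>(empirical n f a - P a) * g a\<bar>)"
    unfolding abs_mult[of "real n"] abs_of_nat by (intro mult_left_mono sum_abs) auto
  also have "\<dots> \<le> real n * (\<Sum>a\<in>UNIV. e * \<bar>g a\<bar>)"
    using assms by (intro mult_left_mono sum_mono) (auto simp: abs_mult typical_def intro: mult_right_mono)
  finally show ?thesis by (simp add: sum_distrib_left)
qed

text \<open>Each letter \<open>c\<close> collects the deviations over its fibre under
  \<open>h\<close>. Their sum is at most the full l1 distance, which is twice the total variation.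
  Projections such as dropping \<open>y\<close> thus preserve typicality.\<close>

lemma typical_map_if_total_variation_le:
  fixes J :: "'a::finite pmf"
  assumes "total_variation (empirical n f) (pmf J) \<le> e"
  shows "typical n (pmf (map_pmf h J)) (2 * e) (\<lambda>k. h (f k))"
  unfolding typical_def
proof
  fix c
  have "empirical n (\<lambda>k. h (f k)) c - pmf (map_pmf h J) c = (\<Sum>a\<in>h -` {c}. empirical n f a - pmf J a)"
    by (simp add: empirical_comp pmf_map measure_measure_pmf_finite sum_subtractf)
  also have "\<bar>\<dots>\<bar> \<le> (\<Sum>a\<in>h -` {c}. \<bar>empirical n f a - pmf J a\<bar>)"
    by (rule sum_abs)
  also have "\<dots> \<le> (\<Sum>a\<in>UNIV. \<bar>empirical n f a - pmf J a\<bar>)"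
    by (intro sum_mono2) auto
  also have "\<dots> \<le> 2 * e"
    using assms by (simp add: total_variation_def)
  finally show "\<bar>empirical n (\<lambda>k. h (f k)) c - pmf (map_pmf h J) c\<bar> \<le> 2 * e" .
qed

lemma total_variation_le_if_typical:
  assumes "typical n P e f"
  shows "total_variation (empirical n f) (P :: 'a::finite \<Rightarrow> real) \<le> real CARD('a) * e"
proof -
  have "(\<Sum>a\<in>UNIV. \<bar>empirical n f a - P a\<bar>) \<le> real CARD('a) * e"
    using assms by (intro sum_bounded_above) (auto simp: typical_def)
  moreover have "0 \<le> (\<Sum>a\<in>UNIV. \<bar>empirical n f a - P a\<bar>)"
    by (intro sum_nonneg) auto
  ultimately show ?thesis
    unfolding total_variation_def by linarith
qed

section \<open>Words of length \<open>n\<close> and product distributions\<close>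

lemma finite_blocks [simp]: "finite (blocks n :: (nat \<Rightarrow> 'a::finite) set)"
  by (auto simp: blocks_def intro: finite_PiE)

lemma card_blocks: "card (blocks n :: (nat \<Rightarrow> 'a::finite) set) = CARD('a) ^ n"
  by (simp add: blocks_def card_PiE)

lemma pmf_Pi_blocks:
  "ys \<in> blocks n \<Longrightarrow> pmf (Pi_pmf {..<n} undefined p) ys = (\<Prod>k<n. pmf (p k) (ys k))"
  by (subst pmf_Pi') (auto simp: blocks_def PiE_def extensional_def)

lemma set_Pi_pmf_blocks: "set_pmf (Pi_pmf {..<n} undefined p) \<subseteq> blocks n"
  using set_Pi_pmf_subset[of "{..<n}" undefined p] by (auto simp: blocks_def PiE_def extensional_def)

lemma prob_Pi_blocks:
  fixes p :: "nat \<Rightarrow> 'a::finite pmf"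
  assumes "T \<subseteq> blocks n"
  shows "measure_pmf.prob (Pi_pmf {..<n} undefined p) T = (\<Sum>ys\<in>T. \<Prod>k<n. pmf (p k) (ys k))"
proof -
  have "finite T" using assms finite_blocks finite_subset by blast
  thus ?thesis using assms
    by (auto simp: measure_measure_pmf_finite pmf_Pi_blocks subset_iff intro!: sum.cong)
qed

lemma prob_Pi_Int_blocks:
  "measure_pmf.prob (Pi_pmf {..<n} undefined p) (T \<inter> blocks n)
     = measure_pmf.prob (Pi_pmf {..<n} undefined p) T"
  using set_Pi_pmf_blocks[of n p]
  by (intro measure_pmf.finite_measure_eq_AE) (auto simp: AE_measure_pmf_iff)

text \<open>Hoeffding's inequality for each pair of letters, then a union bound. The draws are
  independent but not identically distributed. The exact mean of the joint frequency is
  \<open>empirical n s a * pmf (V a) b\<close>, so the bound holds for every side sequence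
  \<open>s\<close>.\<close>

lemma prob_not_typical_le:
  fixes s :: "nat \<Rightarrow> 's::finite" and V :: "'s \<Rightarrow> 'b::finite pmf"
  assumes e: "e > 0"
  shows "measure_pmf.prob (Pi_pmf {..<n} undefined (\<lambda>k. V (s k)))
           {ys. \<not> typical n (\<lambda>(a, b). empirical n s a * pmf (V a) b) e (\<lambda>k. (s k, ys k))}
         \<le> 2 * CARD('s \<times> 'b) * exp (- 2 * real n * e\<^sup>2)"
proof (cases "n = 0")
  case True
  thus ?thesis using e by (simp add: typical_def empirical_def)
next
  case False
  let ?M = "Pi_pmf {..<n} undefined (\<lambda>k. V (s k))"
  let ?X = "\<lambda>a b k ys. of_bool (s k = a \<and> ys k = b) :: real"
  let ?B = "\<lambda>c. {ys. e < \<bar>empirical n (\<lambda>k. (s k, ys k)) c - (case c of (a, b) \<Rightarrow> empirical n s a * pmf (V a) b)\<bar>}"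
  have *: "measure_pmf.prob ?M (?B (a, b)) \<le> 2 * exp (- 2 * real n * e\<^sup>2)" for a b
  proof -
    have E: "measure_pmf.expectation ?M (?X a b k) = of_bool (s k = a) * pmf (V a) b" if "k < n" for k
    proof -
      have "measure_pmf.expectation ?M (?X a b k)
          = measure_pmf.expectation (map_pmf (\<lambda>ys. ys k) ?M) (\<lambda>y. of_bool (s k = a \<and> y = b))"
        by simp
      also have "map_pmf (\<lambda>ys. ys k) ?M = V (s k)"
        using that by (subst Pi_pmf_component) auto
      also have "measure_pmf.expectation (V (s k)) (\<lambda>y. of_bool (s k = a \<and> y = b))
          = (\<Sum>y\<in>UNIV. of_bool (s k = a \<and> y = b) * pmf (V (s k)) y)"
        by (rule integral_measure_pmf_real) auto
      also have "\<dots> = of_bool (s k = a) * pmf (V a) b"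
        by (cases "s k = a") (simp_all add: of_bool_def if_distrib[of "\<lambda>x. x * _"] cong: if_cong)
      finally show ?thesis .
    qed
    interpret Hoeffding_ineq ?M "{..<n}" "?X a b" "\<lambda>_. 0" "\<lambda>_. 1"
      "\<Sum>k<n. measure_pmf.expectation ?M (?X a b k)"
    proof unfold_locales
      have "prob_space.indep_vars ?M (\<lambda>_. borel) (\<lambda>k ys. (\<lambda>y. of_bool (s k = a \<and> y = b)) (ys k)) {..<n}"
        by (rule prob_space.indep_vars_compose2[OF _ indep_vars_Pi_pmf])
           (auto simp: measure_pmf.prob_space_axioms)
      thus "prob_space.indep_vars ?M (\<lambda>_. borel) (?X a b) {..<n}" by simp
    qed (auto simp: measure_pmf.prob_space_axioms)
    have mu: "(\<Sum>k<n. measure_pmf.expectation ?M (?X a b k)) = real n * (empirical n s a * pmf (V a) b)"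
      using False by (simp add: E empirical_def sum_distrib_right)
    have "measure_pmf.prob ?M (?B (a, b))
        \<le> measure_pmf.prob ?M {ys\<in>space ?M. \<bar>(\<Sum>k<n. ?X a b k ys) - (\<Sum>k<n. measure_pmf.expectation ?M (?X a b k))\<bar> \<ge> real n * e}"
    proof (intro measure_pmf.finite_measure_mono subsetI CollectI conjI)
      fix ys assume "ys \<in> ?B (a, b)"
      moreover have "(\<Sum>k<n. ?X a b k ys) = real n * empirical n (\<lambda>k. (s k, ys k)) (a, b)"
        using False by (simp add: empirical_def)
      ultimately show "real n * e \<le> \<bar>(\<Sum>k<n. ?X a b k ys) - (\<Sum>k<n. measure_pmf.expectation ?M (?X a b k))\<bar>"
        unfolding mu
        by (simp add: abs_mult mult_left_mono less_imp_le flip: right_diff_distrib)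
    qed auto
    also have "\<dots> \<le> 2 * exp (- 2 * (real n * e)\<^sup>2 / (\<Sum>k<n. (1 - 0)\<^sup>2))"
      using e False by (intro Hoeffding_ineq_abs_ge) auto
    also have "- 2 * (real n * e)\<^sup>2 / (\<Sum>k<n. (1 - 0)\<^sup>2) = - 2 * real n * e\<^sup>2"
      using False by (simp add: power2_eq_square)
    finally show ?thesis .
  qed
  have "{ys. \<not> typical n (\<lambda>(a, b). empirical n s a * pmf (V a) b) e (\<lambda>k. (s k, ys k))} = (\<Union>c. ?B c)"
    unfolding typical_def not_all not_le by (rule Collect_ex_eq)
  also have "measure_pmf.prob ?M \<dots> \<le> (\<Sum>c\<in>UNIV. measure_pmf.prob ?M (?B c))"
    by (rule measure_pmf.finite_measure_subadditive_finite) auto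
  also have "\<dots> \<le> (\<Sum>c\<in>(UNIV :: ('s \<times> 'b) set). 2 * exp (- 2 * real n * e\<^sup>2))"
    using * by (intro sum_mono) (auto simp del: split_paired_All)
  finally show ?thesis by simp
qed

subsection \<open>Change of measure\<close>

text \<open>Word by word, the \<open>P\<close>-weight is the \<open>Q\<close>-weight times the
  exponential of the summed log ratio. \<open>P\<close> and \<open>Q\<close> are mere nonnegative
  weights, which admits the subnormalised weights of the converse.\<close>

lemma sum_prod_change_of_measure:
  fixes P Q :: "nat \<Rightarrow> 'a::finite \<Rightarrow> real"
  assumes T: "T \<subseteq> blocks n"
    and P: "\<And>k a. P k a \<ge> 0" and Q: "\<And>k a. Q k a \<ge> 0"
    and ac: "\<And>k a. P k a > 0 \<Longrightarrow> Q k a > 0"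
    and B: "\<And>ys. ys \<in> T \<Longrightarrow> (\<Sum>k<n. ln (P k (ys k) / Q k (ys k))) \<le> B"
  shows "(\<Sum>ys\<in>T. \<Prod>k<n. P k (ys k)) \<le> exp B * (\<Sum>ys\<in>T. \<Prod>k<n. Q k (ys k))"
  unfolding sum_distrib_left
proof (rule sum_mono)
  fix ys assume ys: "ys \<in> T"
  show "(\<Prod>k<n. P k (ys k)) \<le> exp B * (\<Prod>k<n. Q k (ys k))"
  \<comment> \<open>The factorisation needs genuine logarithms, hence positive factors; once some
    factor of \<open>P\<close> vanishes, the whole left product is 0.\<close>
  proof (cases "\<forall>k<n. P k (ys k) > 0")
    case True
    have "(\<Prod>k<n. P k (ys k)) = (\<Prod>k<n. exp (ln (P k (ys k) / Q k (ys k))) * Q k (ys k))"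
    proof (rule prod.cong)
      fix k assume "k \<in> {..<n}"
      with True ac have "P k (ys k) > 0" "Q k (ys k) > 0" by auto
      thus "P k (ys k) = exp (ln (P k (ys k) / Q k (ys k))) * Q k (ys k)" by simp
    qed simp
    also have "\<dots> = exp (\<Sum>k<n. ln (P k (ys k) / Q k (ys k))) * (\<Prod>k<n. Q k (ys k))"
      by (simp add: prod.distrib exp_sum)
    also have "\<dots> \<le> exp B * (\<Prod>k<n. Q k (ys k))"
      using B[OF ys] Q by (intro mult_right_mono prod_nonneg) auto
    finally show ?thesis .
  next
    case False
    then obtain k where "k < n" "P k (ys k) = 0"
      using P by (auto simp: not_less intro: antisym)
    hence *: "(\<Prod>k<n. P k (ys k)) = 0" by (intro prod_zero) auto
    show ?thesis unfolding * using Q by (simp add: prod_nonneg)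
  qed
qed

text \<open>Conditional relative entropy D(V || W | P) in nats. Letters with
  \<open>pmf (V a) b = 0\<close> contribute 0, in line with the usual convention.\<close>

definition relative_entropy :: "('s::finite \<Rightarrow> real) \<Rightarrow> ('s \<Rightarrow> 'b::finite pmf) \<Rightarrow> ('s \<Rightarrow> 'b pmf) \<Rightarrow> real" where
  "relative_entropy P V W =
     (\<Sum>(a, b)\<in>UNIV. P a * pmf (V a) b * ln (pmf (V a) b / pmf (W a) b))"

text \<open>Drawn from \<open>V\<close>, the word is jointly typical with probability near 1 by
  concentration. On the typical set, replacing \<open>V\<close> by \<open>W\<close> costs at most
  the exponential of the almost constant log-likelihood ratio.\<close>

lemma prob_typical_ge:
  fixes s :: "nat \<Rightarrow> 's::finite" and V W :: "'s \<Rightarrow> 'b::finite pmf"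
  assumes e: "e > 0" and s: "typical n P d s"
    and ac: "\<And>a. set_pmf (V a) \<subseteq> set_pmf (W a)"
  defines "C \<equiv> \<Sum>(a, b)\<in>UNIV. \<bar>ln (pmf (V a) b / pmf (W a) b)\<bar>"
  shows "measure_pmf.prob (Pi_pmf {..<n} undefined (\<lambda>k. W (s k)))
           {ys \<in> blocks n. typical n (\<lambda>(a, b). P a * pmf (V a) b) (d + e) (\<lambda>k. (s k, ys k))}
         \<ge> (1 - 2 * CARD('s \<times> 'b) * exp (- 2 * real n * e\<^sup>2))
             * exp (- real n * (relative_entropy P V W + (d + e) * C))"
proof -
  let ?T = "{ys \<in> blocks n. typical n (\<lambda>(a, b). P a * pmf (V a) b) (d + e) (\<lambda>k. (s k, ys k))}"
  let ?S = "{ys. typical n (\<lambda>(a, b). empirical n s a * pmf (V a) b) e (\<lambda>k. (s k, ys k))}"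
  let ?V = "Pi_pmf {..<n} undefined (\<lambda>k. V (s k))"
  let ?W = "Pi_pmf {..<n} undefined (\<lambda>k. W (s k))"
  let ?E = "real n * (relative_entropy P V W + (d + e) * C)"
  \<comment> \<open>Triangle inequality: \<open>e\<close> for the random draw around its mean,
    \<open>d\<close> for the distance of the type of \<open>s\<close> from \<open>P\<close>.\<close>
  have sub: "?S \<inter> blocks n \<subseteq> ?T"
  proof (rule subsetI)
    fix ys assume ys: "ys \<in> ?S \<inter> blocks n"
    hence T0: "typical n (\<lambda>(a, b). empirical n s a * pmf (V a) b) e (\<lambda>k. (s k, ys k))" by simp
    have "typical n (\<lambda>(a, b). P a * pmf (V a) b) (d + e) (\<lambda>k. (s k, ys k))"
      unfolding typical_def
    proof (rule allI)
      fix x :: "'s \<times> 'b"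
      obtain a b where x: "x = (a, b)" by (cases x)
      have "\<bar>empirical n (\<lambda>k. (s k, ys k)) (a, b) - empirical n s a * pmf (V a) b\<bar> \<le> e"
        using T0 by (auto simp: typical_def)
      moreover have "\<bar>empirical n s a * pmf (V a) b - P a * pmf (V a) b\<bar> \<le> d * 1"
        unfolding left_diff_distrib[symmetric] abs_mult
        using s by (intro mult_mono) (auto simp: typical_def pmf_le_1 intro: order_trans[OF abs_ge_zero])
      ultimately show "\<bar>empirical n (\<lambda>k. (s k, ys k)) x - (case x of (a, b) \<Rightarrow> P a * pmf (V a) b)\<bar> \<le> d + e"
        unfolding x prod.case by linarith
    qed
    thus "ys \<in> ?T" using ys by simp
  qed
  have "1 - 2 * CARD('s \<times> 'b) * exp (- 2 * real n * e\<^sup>2) \<le> 1 - measure_pmf.prob ?V (- ?S)"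
    using prob_not_typical_le[OF e, of n V s] by (simp add: Collect_neg_eq)
  also have "\<dots> = measure_pmf.prob ?V ?S"
    using measure_pmf.prob_compl[of ?S ?V] by (simp add: Compl_eq_Diff_UNIV)
  also have "\<dots> = measure_pmf.prob ?V (?S \<inter> blocks n)"
    by (rule prob_Pi_Int_blocks[symmetric])
  also have "\<dots> \<le> measure_pmf.prob ?V ?T"
    by (rule measure_pmf.finite_measure_mono[OF sub]) simp
  also have "\<dots> \<le> exp ?E * measure_pmf.prob ?W ?T"
  proof -
    have "(\<Sum>ys\<in>?T. \<Prod>k<n. pmf (V (s k)) (ys k)) \<le> exp ?E * (\<Sum>ys\<in>?T. \<Prod>k<n. pmf (W (s k)) (ys k))"
    proof (rule sum_prod_change_of_measure)
      fix k a assume "0 < pmf (V (s k)) a"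
      thus "0 < pmf (W (s k)) a" using ac by (auto simp: pmf_positive_iff)
    next
      fix ys assume "ys \<in> ?T"
      hence "typical n (\<lambda>(a, b). P a * pmf (V a) b) (d + e) (\<lambda>k. (s k, ys k))" by simp
      from sum_typical_close[OF this, of "\<lambda>(a, b). ln (pmf (V a) b / pmf (W a) b)"]
      show "(\<Sum>k<n. ln (pmf (V (s k)) (ys k) / pmf (W (s k)) (ys k))) \<le> ?E"
        by (simp add: relative_entropy_def C_def case_prod_beta distrib_left)
    qed auto
    thus ?thesis by (simp add: prob_Pi_blocks)
  qed
  finally have "(1 - 2 * CARD('s \<times> 'b) * exp (- 2 * real n * e\<^sup>2)) * exp (- ?E)
      \<le> (exp ?E * measure_pmf.prob ?W ?T) * exp (- ?E)"
    by (intro mult_right_mono) auto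
  also have "\<dots> = measure_pmf.prob ?W ?T"
    by (simp add: exp_minus)
  finally show ?thesis by simp
qed

text \<open>Mutual information in nats; the rates of the codes are in bits, hence the factors \<open>ln 2\<close>.\<close>

definition info :: "('a::finite \<times> 'b::finite) pmf \<Rightarrow> real" where
  "info q = (\<Sum>(a, b)\<in>UNIV. pmf q (a, b) *
     ln (pmf q (a, b) / (pmf (map_pmf fst q) a * pmf (map_pmf snd q) b)))"

lemma pmf_map_snd: "pmf (map_pmf snd q) b = (\<Sum>a\<in>UNIV. pmf q (a :: 'a::finite, b))" for b :: "'b::finite"
proof -
  have "snd -` {b} = (\<lambda>a. (a, b)) ` (UNIV :: 'a set)" by auto
  thus ?thesis by (simp add: pmf_map measure_measure_pmf_finite sum.reindex inj_on_def)
qed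

lemma pmf_le_pmf_map: "pmf q a \<le> pmf (map_pmf f q) (f a)"
  unfolding pmf_map by (simp add: measure_pmf_single[symmetric] measure_pmf.finite_measure_mono)

text \<open>
  The sequences are compared with the smoothed kernel \<open>(1 - l) q(_|c) + l p\<close> rather than \<open>q(_|c)\<close>:
  a typical sequence may contain a few letters of conditional probability \<open>0\<close>, which would make
  the likelihood ratio infinite.
\<close>

lemma prob_typical_le:
  fixes q :: "('a::finite \<times> 'b::finite) pmf" and l :: real
  assumes l: "0 < l" "l < 1"
  shows "\<exists>C\<ge>0. \<forall>n b e. measure_pmf.prob (iid_pmf n (map_pmf fst q))
           {xs. typical n (pmf q) e (\<lambda>k. (xs k, b k))}
         \<le> exp (- real n * (info q + ln (1 - l) - e * C))"
proof (intro exI conjI allI)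
  let ?p = "map_pmf fst q" and ?r = "map_pmf snd q"
  define u where "u c a = (1 - l) * pmf q (a, c) / pmf ?r c + l * pmf ?p a" for c a
  define g where "g = (\<lambda>(a, c). ln (pmf ?p a / u c a))"
  define C where "C = (\<Sum>x\<in>UNIV. \<bar>g x\<bar>)"
  show "C \<ge> 0" by (simp add: C_def sum_nonneg)
  have u_nn: "u c a \<ge> 0" for c a using l by (simp add: u_def)
  \<comment> \<open>The sum is 1 where \<open>c\<close> has positive second marginal; elsewhere
    division by zero leaves only \<open>l\<close>.\<close>
  have u_sum: "(\<Sum>a\<in>UNIV. u c a) \<le> 1" for c
  proof -
    have "(\<Sum>a\<in>UNIV. u c a) = (1 - l) * ((\<Sum>a\<in>UNIV. pmf q (a, c)) / pmf ?r c) + l * (\<Sum>a\<in>UNIV. pmf ?p a)"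
      by (simp add: u_def sum.distrib sum_distrib_left sum_divide_distrib)
    also have "(\<Sum>a\<in>UNIV. pmf ?p a) = 1" by (rule sum_pmf_eq_1) auto
    also have "(\<Sum>a\<in>UNIV. pmf q (a, c)) = pmf ?r c" by (simp add: pmf_map_snd)
    also have "(1 - l) * (pmf ?r c / pmf ?r c) + l * 1 \<le> 1" using l by (cases "pmf ?r c = 0") auto
    finally show ?thesis .
  qed
  have g_sum: "(\<Sum>x\<in>UNIV. pmf q x * g x) \<le> - info q - ln (1 - l)"
  proof -
    have "(\<Sum>x\<in>UNIV. pmf q x * g x) \<le> (\<Sum>(a, c)\<in>UNIV. pmf q (a, c) *
       (- ln (pmf q (a, c) / (pmf ?p a * pmf ?r c)) - ln (1 - l)))"
    proof (intro sum_mono, safe)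
      fix a c
      show "pmf q (a, c) * g (a, c) \<le> pmf q (a, c) * (- ln (pmf q (a, c) / (pmf ?p a * pmf ?r c)) - ln (1 - l))"
      proof (cases "pmf q (a, c) = 0")
        case False
        hence q: "pmf q (a, c) > 0" by (simp add: less_le)
        have p: "pmf ?p a > 0" and r: "pmf ?r c > 0"
          using q pmf_le_pmf_map[of q "(a, c)" fst] pmf_le_pmf_map[of q "(a, c)" snd] by auto
        \<comment> \<open>Dropping the part \<open>l * pmf ?p a\<close> of \<open>u\<close> shrinks
          the denominator and so can only raise the logarithm; the remaining factor
          \<open>1 - l\<close> produces the term \<open>- ln (1 - l)\<close>.\<close>
        define v where "v = (1 - l) * pmf q (a, c) / pmf ?r c"
        have v: "0 < v" "v \<le> u c a" using l q r by (auto simp: v_def u_def)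
        have "g (a, c) \<le> ln (pmf ?p a / v)"
          using v p unfolding g_def by (auto intro!: ln_mono divide_left_mono)
        also have "\<dots> = - ln (pmf q (a, c) / (pmf ?p a * pmf ?r c)) - ln (1 - l)"
          using l q p r by (simp add: v_def ln_div ln_mult)
        finally show ?thesis by (intro mult_left_mono) auto
      qed simp
    qed
    also have "\<dots> = - info q - (\<Sum>x\<in>UNIV. pmf q x) * ln (1 - l)"
      by (simp add: info_def case_prod_beta right_diff_distrib sum_subtractf sum_negf sum_distrib_right)
    also have "(\<Sum>x\<in>UNIV. pmf q x) = 1" by (rule sum_pmf_eq_1) auto
    finally show ?thesis by simp
  qed
  fix n e and b :: "nat \<Rightarrow> 'b"
  let ?T = "{xs. typical n (pmf q) e (\<lambda>k. (xs k, b k))}"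
  let ?E = "- real n * (info q + ln (1 - l) - e * C)"
  have "measure_pmf.prob (iid_pmf n ?p) ?T = measure_pmf.prob (iid_pmf n ?p) (?T \<inter> blocks n)"
    unfolding iid_pmf_def by (rule prob_Pi_Int_blocks[symmetric])
  also have "\<dots> = (\<Sum>xs\<in>?T \<inter> blocks n. \<Prod>k<n. pmf ?p (xs k))"
    unfolding iid_pmf_def by (rule prob_Pi_blocks) auto
  also have "\<dots> \<le> exp ?E * (\<Sum>xs\<in>?T \<inter> blocks n. \<Prod>k<n. u (b k) (xs k))"
  proof (rule sum_prod_change_of_measure)
    fix k a assume "0 < pmf ?p a"
    hence "0 < l * pmf ?p a" using l by simp
    moreover have "0 \<le> (1 - l) * pmf q (a, b k) / pmf ?r (b k)" using l by simp
    ultimately show "0 < u (b k) a" unfolding u_def by linarith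
  next
    fix xs assume "xs \<in> ?T \<inter> blocks n"
    hence "typical n (pmf q) e (\<lambda>k. (xs k, b k))" by simp
    from sum_typical_close[OF this, of g]
    have "(\<Sum>k<n. g (xs k, b k)) \<le> real n * (\<Sum>x\<in>UNIV. pmf q x * g x) + real n * (e * C)"
      by (simp add: C_def)
    also have "\<dots> \<le> real n * (- info q - ln (1 - l)) + real n * (e * C)"
      using g_sum by (intro add_right_mono mult_left_mono) auto
    finally show "(\<Sum>k<n. ln (pmf ?p (xs k) / u (b k) (xs k))) \<le> ?E"
      by (simp add: g_def algebra_simps)
  qed (auto simp: u_nn)
  \<comment> \<open>The typical set is enlarged to all words, over which the sum of products
    factorises into letter sums, each at most 1.\<close>
  also have "(\<Sum>xs\<in>?T \<inter> blocks n. \<Prod>k<n. u (b k) (xs k)) \<le> (\<Sum>xs\<in>blocks n. \<Prod>k<n. u (b k) (xs k))"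
    by (intro sum_mono2) (auto simp: u_nn intro: prod_nonneg)
  also have "(\<Sum>xs\<in>blocks n. \<Prod>k<n. u (b k) (xs k)) = (\<Prod>k<n. \<Sum>a\<in>UNIV. u (b k) a)"
    unfolding blocks_def by (rule prod_sum_PiE[symmetric]) auto
  also have "\<dots> \<le> 1"
    using u_sum u_nn by (intro prod_le_1) (auto intro: sum_nonneg)
  finally show "measure_pmf.prob (iid_pmf n ?p) ?T \<le> exp ?E" by simp
qed

subsection \<open>Converse and closedness of the region\<close>

lemma distributed_measure_pmf:
  "distributed (measure_pmf J) (count_space UNIV) X (\<lambda>a. ennreal (pmf (map_pmf X J) a))"
  using measure_pmf_eq_density[of "map_pmf X J"]
  by (simp add: distributed_def map_pmf_rep_eq)

text \<open>Discrete variables have their mass functions as densities with respect to counting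
  measure, and the product of the two counting measures is again one, so the general definition
  becomes a finite sum.\<close>

lemma mutual_info_eq_info:
  fixes X :: "'a \<Rightarrow> 'b::finite" and Y :: "'a \<Rightarrow> 'c::finite"
  shows "mutual_info J X Y = info (map_pmf (\<lambda>w. (X w, Y w)) J) / ln 2"
proof -
  interpret information_space "measure_pmf J" 2
    by unfold_locales auto
  let ?q = "map_pmf (\<lambda>w. (X w, Y w)) J"
  let ?f = "\<lambda>x. pmf ?q x * log 2 (pmf ?q x / (pmf (map_pmf X J) (fst x) * pmf (map_pmf Y J) (snd x)))"
  have eq: "count_space (UNIV :: 'b set) \<Otimes>\<^sub>M count_space (UNIV :: 'c set) = count_space UNIV"
    by (simp add: pair_measure_count_space)
  have "mutual_info J X Y = integral\<^sup>L (count_space UNIV \<Otimes>\<^sub>M count_space UNIV) ?f"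
    unfolding mutual_info_def
    by (rule mutual_information_distr)
       (simp_all only: eq distributed_measure_pmf pmf_nonneg, simp_all add: sigma_finite_measure_count_space)
  also have "\<dots> = (\<Sum>x\<in>UNIV. ?f x)"
    unfolding eq by (simp add: lebesgue_integral_count_space_finite)
  also have "\<dots> = info ?q / ln 2"
    by (simp add: info_def pmf.map_comp o_def case_prod_beta log_def sum_divide_distrib)
  finally show ?thesis .
qed

lemma messages_eq: "messages n R = {1..nat \<lfloor>2 powr (real n * R)\<rfloor>}"
  by (auto simp: messages_def le_nat_iff le_floor_iff)

lemma powr_eq_exp_rate: "2 powr (real n * R) = exp (real n * (R * ln 2))"
  by (simp add: powr_def)

text \<open>Each fixed reconstruction is typical only with source words of exponentially small total
  probability. If \<open>R\<close> were too small, a union bound over the messages would drive the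
  probability of typicality to 0, below the required \<open>1 / 2\<close>.\<close>

lemma rate_ge_info:
  fixes q :: "('a::finite \<times> 'b::finite) pmf" and dec :: "nat \<Rightarrow> nat \<Rightarrow> nat \<Rightarrow> 'b"
  assumes enc: "\<And>n xs. n \<ge> 1 \<Longrightarrow> xs \<in> blocks n \<Longrightarrow> enc n xs \<in> messages n R"
    and prob: "\<And>e. e > 0 \<Longrightarrow> eventually (\<lambda>n. measure_pmf.prob (iid_pmf n (map_pmf fst q))
        {xs. typical n (pmf q) e (\<lambda>k. (xs k, dec n (enc n xs) k))} \<ge> 1 / 2) sequentially"
  shows "info q \<le> R * ln 2"
proof -
  have le: "info q + ln (1 - l) \<le> R * ln 2" if l: "0 < l" "l < 1" for l
  proof (rule field_le_epsilon)
    fix d :: real assume d: "d > 0"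
    obtain C where C: "C \<ge> 0" and bound: "\<And>n b e. measure_pmf.prob (iid_pmf n (map_pmf fst q))
           {xs. typical n (pmf q) e (\<lambda>k. (xs k, b k))}
         \<le> exp (- real n * (info q + ln (1 - l) - e * C))"
      using prob_typical_le[OF l, of q] by blast
    \<comment> \<open>The tolerance is so small that its cost \<open>e * C\<close> in the exponent
      is at most \<open>d\<close>; the \<open>+ 1\<close> covers \<open>C = 0\<close>.\<close>
    define e where "e = d / (C + 1)"
    have e: "e > 0" "e * C \<le> d" using d C by (auto simp: e_def field_simps)
    define K where "K = info q + ln (1 - l) - e * C"
    have "K \<le> R * ln 2"
    proof (rule ccontr)
      assume "\<not> K \<le> R * ln 2"
      hence neg: "R * ln 2 - K < 0" by simp
      have ub: "measure_pmf.prob (iid_pmf n (map_pmf fst q))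
          {xs. typical n (pmf q) e (\<lambda>k. (xs k, dec n (enc n xs) k))} \<le> exp (real n * (R * ln 2 - K))"
        if n: "n \<ge> 1" for n
      proof -
        let ?P = "iid_pmf n (map_pmf fst q)"
        let ?A = "\<lambda>m. {xs. typical n (pmf q) e (\<lambda>k. (xs k, dec n m k))}"
        have "measure_pmf.prob ?P {xs. typical n (pmf q) e (\<lambda>k. (xs k, dec n (enc n xs) k))}
          = measure_pmf.prob ?P ({xs. typical n (pmf q) e (\<lambda>k. (xs k, dec n (enc n xs) k))} \<inter> blocks n)"
          unfolding iid_pmf_def by (rule prob_Pi_Int_blocks[symmetric])
        \<comment> \<open>The event is split according to the message sent; for a fixed message the
          reconstruction is a fixed word.\<close>
        also have "\<dots> \<le> measure_pmf.prob ?P (\<Union>m\<in>messages n R. ?A m)"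
          using enc[OF n] by (intro measure_pmf.finite_measure_mono) auto
        also have "\<dots> \<le> (\<Sum>m\<in>messages n R. measure_pmf.prob ?P (?A m))"
          by (rule measure_pmf.finite_measure_subadditive_finite) (auto simp: messages_eq)
        also have "\<dots> \<le> real (card (messages n R)) * exp (- real n * K)"
          using bound[of n e] by (intro sum_bounded_above) (auto simp: K_def)
        also have "\<dots> \<le> exp (real n * (R * ln 2)) * exp (- real n * K)"
          by (intro mult_right_mono) (auto simp: messages_eq powr_eq_exp_rate)
        also have "\<dots> = exp (real n * (R * ln 2 - K))"
          by (simp add: exp_add[symmetric] algebra_simps)
        finally show ?thesis .
      qed
      have "eventually (\<lambda>n. exp (real n * (R * ln 2 - K)) < 1 / 2) sequentially"
        using neg by real_asymp
      moreover note prob[OF e(1)]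
      moreover have "eventually (\<lambda>n::nat. n \<ge> 1) sequentially" by (rule eventually_ge_at_top)
      ultimately have "eventually (\<lambda>n. False) sequentially"
        by eventually_elim (use ub in fastforce)
      thus False by simp
    qed
    thus "info q + ln (1 - l) \<le> R * ln 2 + d" using e unfolding K_def by linarith
  qed
  \<comment> \<open>Removal of the smoothing: \<open>l\<close> tends to 0 from the right.\<close>
  have "((\<lambda>l. info q + ln (1 - l)) \<longlongrightarrow> info q + ln (1 - 0)) (at_right (0::real))"
    by (intro tendsto_intros) auto
  moreover have "eventually (\<lambda>l. info q + ln (1 - l) \<le> R * ln 2) (at_right (0::real))"
    using le by (auto simp: eventually_at_right_field intro!: exI[of _ 1])
  ultimately show ?thesis
    by (intro tendsto_upperbound[where F = "at_right (0::real)"]) auto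
qed

section \<open>Rate bounds for achievable channels\<close>

text \<open>The construction of \<open>joint_pmf\<close> for an arbitrary output alphabet, so that
  it also covers the marginal channel to \<open>z\<close>.\<close>

definition graph_pmf :: "'x pmf \<Rightarrow> ('x \<Rightarrow> 'b pmf) \<Rightarrow> ('x \<times> 'b) pmf" where
  "graph_pmf p v = bind_pmf p (\<lambda>x. map_pmf (Pair x) (v x))"

lemma joint_pmf_eq_graph_pmf: "joint_pmf p0 w = graph_pmf p0 w"
  by (simp add: joint_pmf_def graph_pmf_def)

lemma map_fst_graph_pmf: "map_pmf fst (graph_pmf p v) = p"
  by (simp add: graph_pmf_def map_bind_pmf pmf.map_comp o_def bind_return_pmf')

lemma map_graph_pmf: "map_pmf (\<lambda>(x, b). (x, f b)) (graph_pmf p v) = graph_pmf p (\<lambda>x. map_pmf f (v x))"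
  by (simp add: graph_pmf_def map_bind_pmf pmf.map_comp o_def)

lemma pmf_graph_pmf: "pmf (graph_pmf p v) (x, b) = pmf p x * pmf (v x) b"
proof -
  have "pmf (map_pmf (Pair x') (v x')) (x, b) = indicator {x} x' * pmf (v x) b" for x'
  proof (cases "x' = x")
    case True
    have "pmf (map_pmf (Pair x) (v x)) (Pair x b) = pmf (v x) b"
      by (rule pmf_map_inj') (simp add: inj_def)
    with True show ?thesis by simp
  next
    case False
    then have "(x, b) \<notin> set_pmf (map_pmf (Pair x') (v x'))" by auto
    with False show ?thesis by (simp add: pmf_eq_0_set_pmf del: set_map_pmf)
  qed
  then show ?thesis
    by (simp add: graph_pmf_def pmf_bind measure_pmf_single)
qed

lemma info_rates:
  fixes w :: "'x::finite \<Rightarrow> ('y::finite \<times> 'z::finite) pmf"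
  shows "mutual_info (joint_pmf p0 w) (\<lambda>(x, y, z). x) (\<lambda>(x, y, z). (y, z)) = info (graph_pmf p0 w) / ln 2"
    and "mutual_info (joint_pmf p0 w) (\<lambda>(x, y, z). x) (\<lambda>(x, y, z). z)
           = info (graph_pmf p0 (\<lambda>x. map_pmf snd (w x))) / ln 2"
proof -
  have "(\<lambda>t::'x \<times> 'y \<times> 'z. (case t of (x, y, z) \<Rightarrow> x, case t of (x, y, z) \<Rightarrow> (y, z))) = (\<lambda>t. t)"
    by auto
  thus "mutual_info (joint_pmf p0 w) (\<lambda>(x, y, z). x) (\<lambda>(x, y, z). (y, z)) = info (graph_pmf p0 w) / ln 2"
    by (simp only: mutual_info_eq_info joint_pmf_eq_graph_pmf map_pmf_ident)
  have "(\<lambda>t::'x \<times> 'y \<times> 'z. (case t of (x, y, z) \<Rightarrow> x, case t of (x, y, z) \<Rightarrow> z)) = (\<lambda>(x, b). (x, snd b))"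
    by auto
  thus "mutual_info (joint_pmf p0 w) (\<lambda>(x, y, z). x) (\<lambda>(x, y, z). z)
           = info (graph_pmf p0 (\<lambda>x. map_pmf snd (w x))) / ln 2"
    by (simp only: mutual_info_eq_info joint_pmf_eq_graph_pmf map_graph_pmf)
qed

text \<open>A cascade code contains two point-to-point codes: \<open>enc\<close> with the pair of
  reconstructions at rate \<open>R1\<close>, and \<open>rec\<close> after \<open>enc\<close> with
  the \<open>z\<close>-reconstruction at rate \<open>R2\<close>. The rate bound is applied to
  each.\<close>

lemma achievable_imp_rates:
  fixes w :: "'x::finite \<Rightarrow> ('y::finite \<times> 'z::finite) pmf"
  assumes "achievable p0 w R1 R2"
  shows "info (graph_pmf p0 w) \<le> R1 * ln 2"
    and "info (graph_pmf p0 (\<lambda>x. map_pmf snd (w x))) \<le> R2 * ln 2"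
proof -
  let ?J = "joint_pmf p0 w"
  obtain enc rec decy decz where
    code: "\<And>n. n \<ge> 1 \<Longrightarrow> cascade_code R1 R2 n (enc n) (rec n) (decy n) (decz n)" and
    lim: "\<And>e. e > 0 \<Longrightarrow> (\<lambda>n. measure_pmf.prob (iid_pmf n p0)
            {xs. total_variation
                   (joint_type n xs (decy n (enc n xs)) (decz n (rec n (enc n xs))))
                   (pmf ?J) > e}) \<longlonglongrightarrow> 0"
    using assms unfolding achievable_def by auto
  \<comment> \<open>Stated for a general map \<open>h\<close> of letter triples: the identity serves
    \<open>R1\<close>, and the map that drops \<open>y\<close> serves \<open>R2\<close>.\<close>
  have ev: "eventually (\<lambda>n. measure_pmf.prob (iid_pmf n p0)
        {xs. typical n (pmf (map_pmf h ?J)) e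
           (\<lambda>k. h (xs k, decy n (enc n xs) k, decz n (rec n (enc n xs)) k))} \<ge> 1 / 2) sequentially"
    if e: "e > 0" for e and h :: "'x \<times> 'y \<times> 'z \<Rightarrow> 'x \<times> 'b::finite"
  proof -
    have "eventually (\<lambda>n. measure_pmf.prob (iid_pmf n p0)
            {xs. total_variation
                   (joint_type n xs (decy n (enc n xs)) (decz n (rec n (enc n xs))))
                   (pmf ?J) > e / 2} < 1 / 2) sequentially"
      using e by (intro order_tendstoD(2)[OF lim]) auto
    thus ?thesis
    proof eventually_elim
      case (elim n)
      let ?B = "{xs. total_variation
                   (joint_type n xs (decy n (enc n xs)) (decz n (rec n (enc n xs))))
                   (pmf ?J) > e / 2}"
      have "1 / 2 \<le> 1 - measure_pmf.prob (iid_pmf n p0) ?B" using elim by simp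
      also have "\<dots> = measure_pmf.prob (iid_pmf n p0) (- ?B)"
        using measure_pmf.prob_compl[of ?B "iid_pmf n p0"] by (simp add: Compl_eq_Diff_UNIV)
      also have "\<dots> \<le> measure_pmf.prob (iid_pmf n p0)
         {xs. typical n (pmf (map_pmf h ?J)) e
           (\<lambda>k. h (xs k, decy n (enc n xs) k, decz n (rec n (enc n xs)) k))}"
      proof (intro measure_pmf.finite_measure_mono subsetI CollectI)
        fix xs assume "xs \<in> - ?B"
        hence "total_variation (empirical n (\<lambda>k. (xs k, decy n (enc n xs) k, decz n (rec n (enc n xs)) k)))
            (pmf ?J) \<le> e / 2"
          by (simp add: joint_type_eq_empirical not_less)
        from typical_map_if_total_variation_le[OF this, of h]
        show "typical n (pmf (map_pmf h ?J)) e
           (\<lambda>k. h (xs k, decy n (enc n xs) k, decz n (rec n (enc n xs)) k))" by simp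
      qed auto
      finally show ?case .
    qed
  qed
  show "info (graph_pmf p0 w) \<le> R1 * ln 2"
  proof (rule rate_ge_info)
    show "eventually (\<lambda>n. 1 / 2 \<le> measure_pmf.prob (iid_pmf n (map_pmf fst (graph_pmf p0 w)))
        {xs. typical n (pmf (graph_pmf p0 w)) e
           (\<lambda>k. (xs k, (\<lambda>n m k. (decy n m k, decz n (rec n m) k)) n (enc n xs) k))}) sequentially"
      if "e > 0" for e
      using ev[OF that, of "\<lambda>x. x"] by (simp add: map_fst_graph_pmf joint_pmf_eq_graph_pmf)
    show "enc n xs \<in> messages n R1" if "n \<ge> 1" "xs \<in> blocks n" for n xs
      using code[OF that(1)] that(2) by (auto simp: cascade_code_def)
  qed
  show "info (graph_pmf p0 (\<lambda>x. map_pmf snd (w x))) \<le> R2 * ln 2"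
  proof (rule rate_ge_info)
    show "eventually (\<lambda>n. 1 / 2 \<le> measure_pmf.prob (iid_pmf n (map_pmf fst (graph_pmf p0 (\<lambda>x. map_pmf snd (w x)))))
        {xs. typical n (pmf (graph_pmf p0 (\<lambda>x. map_pmf snd (w x)))) e
           (\<lambda>k. (xs k, decz n ((\<lambda>n xs. rec n (enc n xs)) n xs) k))}) sequentially"
      if "e > 0" for e
      using ev[OF that, of "\<lambda>(x, b). (x, snd b)"]
      by (simp add: map_fst_graph_pmf joint_pmf_eq_graph_pmf map_graph_pmf)
    show "rec n (enc n xs) \<in> messages n R2" if "n \<ge> 1" "xs \<in> blocks n" for n xs
      using code[OF that(1)] that(2) by (auto simp: cascade_code_def)
  qed
qed

section \<open>Continuity of mutual information and closedness of the rate region\<close>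

text \<open>Cutting off at 0 makes t ln t continuous on the whole real line, so that closedness can
  be shown in the full space of real functions.\<close>

definition xlnx :: "real \<Rightarrow> real" where
  "xlnx t = max 0 t * ln (max 0 t)"

lemma continuous_on_xlnx: "continuous_on UNIV xlnx"
proof -
  have "isCont xlnx t" for t
  proof (cases t "0 :: real" rule: linorder_cases)
    case less
    have "eventually (\<lambda>s. xlnx s = 0) (nhds t)"
      using eventually_nhds_in_open[of "{..<0}" t] less
      by (auto elim!: eventually_mono simp: xlnx_def)
    thus ?thesis by (subst isCont_cong) auto
  next
    case greater
    have "eventually (\<lambda>s. xlnx s = s * ln s) (nhds t)"
      using eventually_nhds_in_open[of "{0<..}" t] greater
      by (auto elim!: eventually_mono simp: xlnx_def)
    thus ?thesis using greater by (subst isCont_cong) (auto intro!: continuous_intros)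
  next
    case equal
    have "((\<lambda>s::real. s * ln s) \<longlongrightarrow> 0) (at_right 0)" by real_asymp
    moreover have "eventually (\<lambda>s. s * ln s = xlnx s) (at_right 0)"
      by (auto simp: eventually_at_right_field xlnx_def intro!: exI[of _ 1])
    ultimately have R: "(xlnx \<longlongrightarrow> 0) (at_right 0)"
      by (rule Lim_transform_eventually)
    have "eventually (\<lambda>s. 0 = xlnx s) (at_left 0)"
      by (auto simp: eventually_at_left_field xlnx_def intro!: exI[of _ "-1"])
    with tendsto_const have "(xlnx \<longlongrightarrow> 0) (at_left 0)"
      by (rule Lim_transform_eventually)
    with R have "(xlnx \<longlongrightarrow> 0) (at 0)" by (simp add: filterlim_split_at)
    thus ?thesis by (simp add: equal isCont_def xlnx_def)
  qed
  thus ?thesis by (simp add: continuous_at_imp_continuous_on)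
qed

lemma continuous_on_xlnx_comp [continuous_intros]:
  "continuous_on A f \<Longrightarrow> continuous_on A (\<lambda>t. xlnx (f t))"
  using continuous_on_compose2[OF continuous_on_xlnx] by blast

text \<open>This is H(B) - H(B|X), with each entropy written through \<open>xlnx\<close>. Free of
  quotients, the form is continuous in the channel even where probabilities vanish.\<close>

lemma info_graph_pmf:
  fixes p :: "'x::finite pmf" and v :: "'x \<Rightarrow> 'b::finite pmf"
  shows "info (graph_pmf p v) = (\<Sum>x\<in>UNIV. pmf p x * (\<Sum>b\<in>UNIV. xlnx (pmf (v x) b)))
           - (\<Sum>b\<in>UNIV. xlnx (\<Sum>x\<in>UNIV. pmf p x * pmf (v x) b))"
proof -
  define r where "r = (\<lambda>b. \<Sum>x\<in>UNIV. pmf p x * pmf (v x) b)"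
  have r: "r b = pmf (map_pmf snd (graph_pmf p v)) b" for b
    by (simp add: pmf_map_snd pmf_graph_pmf r_def)
  have "info (graph_pmf p v) = (\<Sum>x\<in>UNIV. \<Sum>b\<in>UNIV. pmf p x * xlnx (pmf (v x) b) - pmf p x * pmf (v x) b * ln (r b))"
    unfolding info_def UNIV_Times_UNIV[symmetric] sum.cartesian_product[symmetric]
  proof (intro sum.cong refl)
    fix x b
    show "pmf (graph_pmf p v) (x, b) * ln (pmf (graph_pmf p v) (x, b) /
         (pmf (map_pmf fst (graph_pmf p v)) x * pmf (map_pmf snd (graph_pmf p v)) b))
       = pmf p x * xlnx (pmf (v x) b) - pmf p x * pmf (v x) b * ln (r b)"
    proof (cases "pmf p x * pmf (v x) b = 0")
      case True
      thus ?thesis by (auto simp: pmf_graph_pmf xlnx_def)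
    next
      case False
      hence pos: "pmf p x > 0" "pmf (v x) b > 0" by (auto simp: less_le)
      hence "r b > 0"
        using pmf_le_pmf_map[of "graph_pmf p v" "(x, b)" snd]
        by (auto simp: r pmf_graph_pmf intro: less_le_trans[OF mult_pos_pos])
      hence L: "ln (pmf p x * pmf (v x) b / (pmf p x * r b)) = ln (pmf (v x) b) - ln (r b)"
        using pos by (simp add: ln_div)
      show ?thesis using pos
        unfolding pmf_graph_pmf map_fst_graph_pmf r[symmetric] L by (simp add: xlnx_def algebra_simps)
    qed
  qed
  also have "\<dots> = (\<Sum>x\<in>UNIV. pmf p x * (\<Sum>b\<in>UNIV. xlnx (pmf (v x) b)))
      - (\<Sum>x\<in>UNIV. \<Sum>b\<in>UNIV. pmf p x * pmf (v x) b * ln (r b))"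
    by (simp add: sum_subtractf sum_distrib_left)
  also have "(\<Sum>x\<in>UNIV. \<Sum>b\<in>UNIV. pmf p x * pmf (v x) b * ln (r b)) = (\<Sum>b\<in>UNIV. r b * ln (r b))"
    by (subst sum.swap) (simp add: r_def sum_distrib_right)
  also have "\<dots> = (\<Sum>b\<in>UNIV. xlnx (r b))"
    by (simp add: xlnx_def r)
  finally show ?thesis by (simp add: r_def)
qed

lemma ex_pmf_eq:
  fixes f :: "'a::finite \<Rightarrow> real"
  assumes "\<And>a. f a \<ge> 0" "(\<Sum>a\<in>UNIV. f a) = 1"
  shows "\<exists>p. pmf p = f"
proof
  have "(\<integral>\<^sup>+a. ennreal (f a) \<partial>count_space UNIV) = 1"
    using assms by (simp add: nn_integral_count_space_finite sum_ennreal)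
  thus "pmf (embed_pmf f) = f" using assms by (intro ext pmf_embed_pmf) auto
qed

text \<open>Being a channel is a closed condition on real functions (nonnegative, rows summing to
  1), and the two rate conditions are nonstrict inequalities between continuous functions of the
  rates and the channel.\<close>

lemma closed_rate_region:
  fixes p :: "'x::finite pmf"
  shows "closed {(R1, R2, \<lambda>x. pmf (w x)) | R1 R2 (w :: 'x \<Rightarrow> ('y::finite \<times> 'z::finite) pmf).
    info (graph_pmf p w) \<le> R1 * ln 2 \<and> info (graph_pmf p (\<lambda>x. map_pmf snd (w x))) \<le> R2 * ln 2}"
    (is "closed ?S")
proof -
  let ?I = "\<lambda>v. (\<Sum>x\<in>UNIV. pmf p x * (\<Sum>b\<in>UNIV. xlnx (v x b)))
           - (\<Sum>b\<in>UNIV. xlnx (\<Sum>x\<in>UNIV. pmf p x * v x b))"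
  let ?I' = "\<lambda>v. (\<Sum>x\<in>UNIV. pmf p x * (\<Sum>z\<in>UNIV. xlnx (\<Sum>y\<in>UNIV. v x (y, z))))
           - (\<Sum>z\<in>UNIV. xlnx (\<Sum>x\<in>UNIV. pmf p x * (\<Sum>y\<in>UNIV. v x (y, z))))"
  let ?C = "{t :: real \<times> real \<times> ('x \<Rightarrow> 'y \<times> 'z \<Rightarrow> real).
     (\<forall>x b. 0 \<le> snd (snd t) x b) \<and> (\<forall>x. (\<Sum>b\<in>UNIV. snd (snd t) x b) = 1) \<and>
     ?I (snd (snd t)) \<le> fst t * ln 2 \<and> ?I' (snd (snd t)) \<le> fst (snd t) * ln 2}"
  have "?S = ?C"
  proof (intro equalityI subsetI)
    fix t assume "t \<in> ?S"
    thus "t \<in> ?C"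
      by (auto simp: info_graph_pmf pmf_map_snd sum_pmf_eq_1)
  next
    fix t assume t: "t \<in> ?C"
    have "\<forall>x. \<exists>q. pmf q = snd (snd t) x"
      using t by (intro allI ex_pmf_eq) auto
    then obtain w where w: "\<And>x. pmf (w x) = snd (snd t) x" by metis
    have "t = (fst t, fst (snd t), \<lambda>x. pmf (w x))" by (simp add: w)
    moreover have "info (graph_pmf p w) \<le> fst t * ln 2"
      "info (graph_pmf p (\<lambda>x. map_pmf snd (w x))) \<le> fst (snd t) * ln 2"
      using t by (auto simp: info_graph_pmf pmf_map_snd w)
    ultimately show "t \<in> ?S" by blast
  qed
  moreover have "closed ?C"
  proof -
    have v: "continuous_on UNIV (\<lambda>t :: real \<times> real \<times> ('x \<Rightarrow> 'y \<times> 'z \<Rightarrow> real). snd (snd t) x b)" for x b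
      by (rule continuous_on_product_then_coordinatewise[OF continuous_on_product_then_coordinatewise
            [OF continuous_on_snd[OF continuous_on_snd[OF continuous_on_id]]]])
    show ?thesis
      by (intro closed_Collect_conj closed_Collect_all closed_Collect_le closed_Collect_eq
          v continuous_on_xlnx_comp continuous_on_diff continuous_on_sum continuous_on_mult
          continuous_on_const continuous_on_fst continuous_on_snd continuous_on_id)
  qed
  ultimately show ?thesis by simp
qed

subsection \<open>Covering\<close>

lemma typical_mono: "typical n P d f \<Longrightarrow> d \<le> e \<Longrightarrow> typical n P e f"
  by (fastforce simp: typical_def intro: order_trans)

lemma prob_eq_sum_of_bool:
  assumes "finite (set_pmf M)"
  shows "measure_pmf.prob M {y. R y} = (\<Sum>y\<in>set_pmf M. pmf M y * of_bool (R y))"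
proof -
  have "measure_pmf.prob M {y. R y} = measure_pmf.prob M ({y. R y} \<inter> set_pmf M)"
    by (simp add: measure_Int_set_pmf)
  also have "\<dots> = (\<Sum>y\<in>{y. R y} \<inter> set_pmf M. pmf M y)"
    using assms by (intro measure_measure_pmf_finite) auto
  also have "\<dots> = (\<Sum>y\<in>set_pmf M. pmf M y * of_bool (R y))"
    using assms by (intro sum.mono_neutral_cong_left) auto
  finally show ?thesis .
qed

text \<open>Averaging: each uncovered \<open>x\<close> is hit by a random \<open>y\<close> with
  probability at least \<open>q\<close>, so some \<open>y\<close> in the support covers at least a
  fraction \<open>q\<close> of the uncovered set. Adding it multiplies the number left over by at
  most \<open>1 - q\<close>.\<close>

lemma greedy_covering:
  fixes q :: real
  assumes fin: "finite (set_pmf M)" "finite A" and q: "q \<le> 1"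
    and cov: "\<And>x. x \<in> A \<Longrightarrow> q \<le> measure_pmf.prob M {y. R x y}"
  shows "\<exists>B\<subseteq>set_pmf M. finite B \<and> card B \<le> m \<and>
           real (card {x \<in> A. \<forall>y\<in>B. \<not> R x y}) \<le> (1 - q) ^ m * real (card A)"
proof (induction m)
  case 0
  thus ?case by (intro exI[of _ "{}"]) auto
next
  case (Suc m)
  then obtain B where B: "B \<subseteq> set_pmf M" "finite B" "card B \<le> m"
    "real (card {x \<in> A. \<forall>y\<in>B. \<not> R x y}) \<le> (1 - q) ^ m * real (card A)" by blast
  define U where "U = {x \<in> A. \<forall>y\<in>B. \<not> R x y}"
  have U: "finite U" "U \<subseteq> A" using fin by (auto simp: U_def)
  \<comment> \<open>Otherwise every \<open>y\<close> covers strictly less, and double counting the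
    related pairs, weighted by \<open>M\<close>, contradicts the lower bound
    \<open>q\<close>.\<close>
  have "\<exists>y\<in>set_pmf M. q * real (card U) \<le> real (card {x \<in> U. R x y})"
  proof (rule ccontr)
    assume neg: "\<not> ?thesis"
    have "q * real (card U) = (\<Sum>x\<in>U. q)" by simp
    also have "\<dots> \<le> (\<Sum>x\<in>U. measure_pmf.prob M {y. R x y})"
      using cov U by (intro sum_mono) auto
    also have "\<dots> = (\<Sum>y\<in>set_pmf M. pmf M y * real (card {x \<in> U. R x y}))"
      unfolding prob_eq_sum_of_bool[OF fin(1)] using U
      by (subst sum.swap) (simp add: sum_distrib_left[symmetric] Int_def)
    also have "\<dots> < (\<Sum>y\<in>set_pmf M. pmf M y * (q * real (card U)))"
      using neg fin by (intro sum_strict_mono mult_strict_left_mono)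
        (auto simp: set_pmf_not_empty pmf_positive not_le)
    also have "\<dots> = q * real (card U)"
      using fin by (simp add: sum_distrib_right[symmetric] sum_pmf_eq_1)
    finally show False by simp
  qed
  then obtain y where y: "y \<in> set_pmf M" "q * real (card U) \<le> real (card {x \<in> U. R x y})" by blast
  have "{x \<in> A. \<forall>y\<in>insert y B. \<not> R x y} = U - {x \<in> U. R x y}" by (auto simp: U_def)
  hence "real (card {x \<in> A. \<forall>y\<in>insert y B. \<not> R x y}) = real (card U) - real (card {x \<in> U. R x y})"
    using U by (simp add: card_Diff_subset of_nat_diff card_mono)
  also have "\<dots> \<le> (1 - q) * real (card U)" using y by (simp add: algebra_simps)
  also have "\<dots> \<le> (1 - q) * ((1 - q) ^ m * real (card A))"
    using B(4) q unfolding U_def by (intro mult_left_mono) auto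
  finally show ?case using B y
    by (intro exI[of _ "insert y B"]) (auto simp: card_insert_if)
qed

text \<open>Since \<open>(1 - q) ^ m \<le> exp (- q) ^ m\<close>, the greedy choice leaves fewer
  than one point uncovered, hence none.\<close>

lemma covering:
  assumes fin: "finite (set_pmf M)" "finite A"
    and cov: "\<And>x. x \<in> A \<Longrightarrow> q \<le> measure_pmf.prob M {y. R x y}"
    and m: "ln (real (card A)) < real m * q"
  shows "\<exists>B\<subseteq>set_pmf M. finite B \<and> card B \<le> m \<and> (\<forall>x\<in>A. \<exists>y\<in>B. R x y)"
proof (cases "A = {}")
  \<comment> \<open>For empty \<open>A\<close> the covering hypothesis is vacuous and does not give
    \<open>q \<le> 1\<close>.\<close>
  case True
  thus ?thesis by (intro exI[of _ "{}"]) auto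
next
  case False
  then obtain x where "x \<in> A" by blast
  hence q: "q \<le> 1" using cov[of x] measure_pmf.prob_le_1 order_trans by blast
  obtain B where B: "B \<subseteq> set_pmf M" "finite B" "card B \<le> m"
    "real (card {x \<in> A. \<forall>y\<in>B. \<not> R x y}) \<le> (1 - q) ^ m * real (card A)"
    using greedy_covering[of M A q R m, OF fin q cov] by auto
  note B(4)
  also have "(1 - q) ^ m * real (card A) \<le> exp (- q) ^ m * real (card A)"
    using q exp_ge_add_one_self[of "- q"] by (intro mult_right_mono power_mono) auto
  also have "\<dots> = exp (ln (real (card A)) - real m * q)"
  proof -
    have "exp (- q) ^ m = exp (- (real m * q))" by (simp add: exp_of_nat_mult[symmetric])
    moreover have "real (card A) = exp (ln (real (card A)))" using False fin by (simp add: card_gt_0_iff)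
    ultimately have "exp (- q) ^ m * real (card A) = exp (- (real m * q)) * exp (ln (real (card A)))" by simp
    thus ?thesis by (simp add: exp_add[symmetric])
  qed
  also have "\<dots> < 1" using m by simp
  finally have "card {x \<in> A. \<forall>y\<in>B. \<not> R x y} = 0" by simp
  hence "{x \<in> A. \<forall>y\<in>B. \<not> R x y} = {}" using fin by simp
  hence "\<forall>x\<in>A. \<exists>y\<in>B. R x y" by auto
  with B(1-3) show ?thesis by (intro exI[of _ B] conjI)
qed

text \<open>Codewords are drawn from the product of the \<open>W (cs k)\<close>. A draw fits a given
  typical \<open>xs\<close> with probability about exp(-n D), where D is the relative entropy. The
  number of words to cover enters only through its logarithm, linear in \<open>n\<close>, which
  exp(n (R - D) / 2) outgrows. Both \<open>d\<close> and the threshold for \<open>n\<close> are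
  uniform in \<open>cs\<close>.\<close>

lemma conditional_covering:
  fixes P :: "'x::finite \<times> 'c::finite \<Rightarrow> real" and V :: "'x \<times> 'c \<Rightarrow> 'b::finite pmf" and W :: "'c \<Rightarrow> 'b pmf"
  assumes ac: "\<And>x c. set_pmf (V (x, c)) \<subseteq> set_pmf (W c)"
    and R: "relative_entropy P V (\<lambda>(x, c). W c) < R" "0 < R" and e: "e > 0"
  shows "\<exists>d>0. eventually (\<lambda>n. \<forall>cs. \<exists>B\<subseteq>blocks n. finite B \<and> real (card B) \<le> exp (real n * R) \<and>
     (\<forall>xs\<in>blocks n. typical n P d (\<lambda>k. (xs k, cs k)) \<longrightarrow>
        (\<exists>ys\<in>B. typical n (\<lambda>(a, b). P a * pmf (V a) b) e (\<lambda>k. ((xs k, cs k), ys k))))) sequentially"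
proof -
  let ?W = "\<lambda>(x::'x, c). W c"
  have ac': "set_pmf (V a) \<subseteq> set_pmf (?W a)" for a
    using ac by (cases a) auto
  define D where "D = relative_entropy P V ?W"
  define C where "C = (\<Sum>(a, b)\<in>UNIV. \<bar>ln (pmf (V a) b / pmf (?W a) b)\<bar>)"
  have C: "C \<ge> 0" by (auto simp: C_def intro!: sum_nonneg)
  \<comment> \<open>the loss \<open>2 d C\<close> in the exponent is at most half of the slack \<open>R - D\<close>\<close>
  define d where "d = min (e / 2) ((R - D) / (4 * (C + 1)))"
  have d: "d > 0" "d + d \<le> e" using e C R by (auto simp: d_def D_def)
  have "d \<le> (R - D) / (4 * (C + 1))" by (simp add: d_def)
  hence "d * (4 * (C + 1)) \<le> R - D" using C by (simp add: pos_le_divide_eq)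
  hence dC: "D + (d + d) * C \<le> (D + R) / 2" using d by (simp add: algebra_simps)
  define L where "L = ln (real CARD('x)) + 1"
  have L: "L > 0" by (auto simp: L_def intro!: add_nonneg_pos)
  \<comment> \<open>What remains of \<open>R\<close> after the effective exponent
    \<open>(D + R) / 2\<close>.\<close>
  define \<eta> where "\<eta> = (R - D) / 2"
  have \<eta>: "\<eta> > 0" using R by (simp add: \<eta>_def D_def)
  have ev1: "eventually (\<lambda>n::nat. 2 * real CARD(('x \<times> 'c) \<times> 'b) * exp (- 2 * real n * d\<^sup>2) < 1 / 2) sequentially"
  proof (rule order_tendstoD(2))
    show "((\<lambda>n::nat. 2 * real CARD(('x \<times> 'c) \<times> 'b) * exp (- 2 * real n * d\<^sup>2)) \<longlongrightarrow> 0) sequentially"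
      using d(1) by real_asymp
  qed simp
  have ev2: "eventually (\<lambda>n::nat. 1 \<le> exp (real n * R) / 2) sequentially"
    using R(2) by real_asymp
  have ev3: "eventually (\<lambda>n::nat. real n * L < exp (real n * \<eta>) / 4) sequentially"
    using L \<eta> by real_asymp
  from ev1 ev2 ev3
  have "eventually (\<lambda>n. \<forall>cs. \<exists>B\<subseteq>blocks n. finite B \<and> real (card B) \<le> exp (real n * R) \<and>
     (\<forall>xs\<in>blocks n. typical n P d (\<lambda>k. (xs k, cs k)) \<longrightarrow>
        (\<exists>ys\<in>B. typical n (\<lambda>(a, b). P a * pmf (V a) b) e (\<lambda>k. ((xs k, cs k), ys k))))) sequentially"
  proof eventually_elim
    case (elim n)
    show ?case
    proof
      fix cs :: "nat \<Rightarrow> 'c"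
      define M where "M = Pi_pmf {..<n} undefined (\<lambda>k. W (cs k))"
      \<comment> \<open>\<open>q\<close> bounds the probability of a fit from below; its factor
        \<open>1 / 2\<close> comes from the concentration bound. \<open>m\<close> is the admissible
        number of codewords rounded down, for large \<open>n\<close> still at least half of
        it.\<close>
      define q where "q = exp (- real n * ((D + R) / 2)) / 2"
      define m where "m = nat \<lfloor>exp (real n * R)\<rfloor>"
      define A where "A = {xs \<in> blocks n. typical n P d (\<lambda>k. (xs k, cs k))}"
      have M: "set_pmf M \<subseteq> blocks n" unfolding M_def by (rule set_Pi_pmf_blocks)
      have finM: "finite (set_pmf M)" using M finite_blocks by (rule finite_subset)
      have finA: "finite A" by (auto simp: A_def)
      have "\<exists>B\<subseteq>set_pmf M. finite B \<and> card B \<le> m \<and> (\<forall>xs\<in>A. \<exists>ys\<in>B.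
         typical n (\<lambda>(a, b). P a * pmf (V a) b) e (\<lambda>k. ((xs k, cs k), ys k)))"
      proof (rule covering[OF finM finA])
        fix xs assume "xs \<in> A"
        hence tp: "typical n P d (\<lambda>k. (xs k, cs k))" by (simp add: A_def)
        have le: "real n * (D + (d + d) * C) \<le> real n * ((D + R) / 2)"
          using dC by (rule mult_left_mono) simp
        have "q = 1 / 2 * exp (- real n * ((D + R) / 2))" by (simp add: q_def)
        also have "\<dots> \<le> (1 - 2 * CARD(('x \<times> 'c) \<times> 'b) * exp (- 2 * real n * d\<^sup>2))
             * exp (- real n * (D + (d + d) * C))"
          using elim(1) le by (intro mult_mono) auto
        also have "\<dots> \<le> measure_pmf.prob M {ys \<in> blocks n.
            typical n (\<lambda>(a, b). P a * pmf (V a) b) (d + d) (\<lambda>k. ((xs k, cs k), ys k))}"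
          using prob_typical_ge[OF d(1) tp, of V ?W, OF ac'] by (simp add: M_def D_def C_def)
        also have "\<dots> \<le> measure_pmf.prob M {ys.
            typical n (\<lambda>(a, b). P a * pmf (V a) b) e (\<lambda>k. ((xs k, cs k), ys k))}"
          by (rule measure_pmf.finite_measure_mono) (auto intro: typical_mono[OF _ d(2)])
        finally show "q \<le> measure_pmf.prob M {ys.
            typical n (\<lambda>(a, b). P a * pmf (V a) b) e (\<lambda>k. ((xs k, cs k), ys k))}" .
      next
        have "card A \<le> CARD('x) ^ n"
          unfolding A_def card_blocks[symmetric] by (intro card_mono) auto
        hence "ln (real (card A)) \<le> ln (real (CARD('x) ^ n))"
          by (cases "card A = 0") (auto simp del: of_nat_power intro!: ln_ge_zero)
        also have "\<dots> \<le> real n * L" by (simp add: ln_realpow L_def mult_left_mono)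
        also have "\<dots> < exp (real n * \<eta>) / 4" by (rule elim(3))
        also have "\<dots> = exp (real n * R) / 2 * q"
          by (simp add: q_def \<eta>_def exp_add[symmetric] field_simps)
        also have "\<dots> \<le> real m * q"
        proof (rule mult_right_mono)
          have "exp (real n * R) - 1 \<le> real m" unfolding m_def by linarith
          thus "exp (real n * R) / 2 \<le> real m" using elim(2) by linarith
        qed (simp add: q_def)
        finally show "ln (real (card A)) < real m * q" .
      qed
      then obtain B where B: "B \<subseteq> set_pmf M" "finite B" "card B \<le> m" "\<forall>xs\<in>A. \<exists>ys\<in>B.
         typical n (\<lambda>(a, b). P a * pmf (V a) b) e (\<lambda>k. ((xs k, cs k), ys k))" by blast
      have "real (card B) \<le> real m" using B(3) by simp
      also have "\<dots> \<le> exp (real n * R)" unfolding m_def by (simp add: of_nat_floor)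
      finally show "\<exists>B\<subseteq>blocks n. finite B \<and> real (card B) \<le> exp (real n * R) \<and>
         (\<forall>xs\<in>blocks n. typical n P d (\<lambda>k. (xs k, cs k)) \<longrightarrow>
            (\<exists>ys\<in>B. typical n (\<lambda>(a, b). P a * pmf (V a) b) e (\<lambda>k. ((xs k, cs k), ys k))))"
        using B M unfolding A_def by (intro exI[of _ B]) auto
    qed
  qed
  with d(1) show ?thesis by blast
qed

section \<open>Relative entropy and conditional kernels\<close>

text \<open>Gibbs' inequality: by \<open>ln u \<le> u - 1\<close> each term is at least
  \<open>P a * (pmf (V a) b - pmf (W a) b)\<close>, and these bounds sum to 0 because both kernels
  are normalised.\<close>

lemma relative_entropy_nonneg:
  assumes P: "\<And>a. P a \<ge> 0" and ac: "\<And>a. set_pmf (V a) \<subseteq> set_pmf (W a)"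
  shows "relative_entropy P V W \<ge> 0"
proof -
  have "(\<Sum>(a, b)\<in>UNIV. P a * (pmf (V a) b - pmf (W a) b)) \<le> relative_entropy P V W"
    unfolding relative_entropy_def
  proof (intro sum_mono, clarify)
    fix a b
    have "pmf (V a) b - pmf (W a) b \<le> pmf (V a) b * ln (pmf (V a) b / pmf (W a) b)"
    proof (cases "pmf (V a) b = 0")
      case False
      hence pos: "pmf (V a) b > 0" "pmf (W a) b > 0"
        using ac[of a] by (auto simp: pmf_positive_iff set_pmf_iff)
      have "ln (pmf (W a) b / pmf (V a) b) \<le> pmf (W a) b / pmf (V a) b - 1"
        using pos by (intro ln_le_minus_one) auto
      hence "pmf (V a) b * (1 - pmf (W a) b / pmf (V a) b) \<le> pmf (V a) b * ln (pmf (V a) b / pmf (W a) b)"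
        using pos by (intro mult_left_mono) (auto simp: ln_div)
      moreover have "pmf (V a) b * (1 - pmf (W a) b / pmf (V a) b) = pmf (V a) b - pmf (W a) b"
        using pos by (simp add: right_diff_distrib)
      ultimately show ?thesis by simp
    qed simp
    thus "P a * (pmf (V a) b - pmf (W a) b) \<le> P a * pmf (V a) b * ln (pmf (V a) b / pmf (W a) b)"
      using P by (simp add: mult.assoc mult_left_mono)
  qed
  moreover have "(\<Sum>(a, b)\<in>UNIV. P a * (pmf (V a) b - pmf (W a) b)) = 0"
    unfolding UNIV_Times_UNIV[symmetric] sum.cartesian_product[symmetric]
    by (simp add: sum_distrib_left[symmetric] sum_subtractf sum_pmf_eq_1)
  ultimately show ?thesis by simp
qed

text \<open>
  The fallback outside the support of the first marginal keeps \<open>cond_kernel Q a\<close> absolutely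
  continuous with respect to the second marginal for every \<open>a\<close>.
\<close>

definition cond_kernel :: "('a \<times> 'b) pmf \<Rightarrow> 'a \<Rightarrow> 'b pmf" where
  "cond_kernel Q a = map_pmf snd (if a \<in> fst ` set_pmf Q then cond_pmf Q (fst -` {a}) else Q)"

lemma set_cond_kernel:
  "a \<in> fst ` set_pmf Q \<Longrightarrow> set_pmf (cond_kernel Q a) = {b. (a, b) \<in> set_pmf Q}"
  unfolding cond_kernel_def by (subst if_P, assumption, subst set_map_pmf, subst set_cond_pmf) force+

lemma set_cond_kernel_subset: "set_pmf (cond_kernel Q a) \<subseteq> set_pmf (map_pmf snd Q)"
proof (cases "a \<in> fst ` set_pmf Q")
  case True
  show ?thesis unfolding set_cond_kernel[OF True] by force
qed (simp add: cond_kernel_def)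

text \<open>Disintegration of \<open>Q\<close>. On the support of the first marginal the
  conditioning event has positive mass; off it both sides are 0.\<close>

lemma pmf_cond_kernel: "pmf (map_pmf fst Q) a * pmf (cond_kernel Q a) b = pmf Q (a, b)"
proof (cases "a \<in> fst ` set_pmf Q")
  case True
  hence ne: "set_pmf Q \<inter> fst -` {a} \<noteq> {}" by auto
  let ?m = "measure_pmf.prob Q (fst -` {a})"
  have m: "?m > 0" using True by (simp add: pmf_map[symmetric] pmf_positive_iff)
  have "pmf (cond_kernel Q a) b = measure_pmf.prob (cond_pmf Q (fst -` {a})) (snd -` {b})"
    using True by (simp add: cond_kernel_def pmf_map)
  also have "\<dots> = measure_pmf.prob (cond_pmf Q (fst -` {a})) {(a, b)}"
    using ne by (intro measure_pmf.finite_measure_eq_AE) (auto simp: AE_measure_pmf_iff)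
  also have "\<dots> = pmf Q (a, b) / ?m"
    using ne by (simp add: measure_pmf_single pmf_cond)
  finally show ?thesis using m by (simp add: pmf_map)
next
  case False
  hence "(a, b) \<notin> set_pmf Q" "a \<notin> set_pmf (map_pmf fst Q)" by force+
  thus ?thesis by (simp add: set_pmf_iff del: set_map_pmf)
qed

lemma sum_pmf_map:
  fixes J :: "'a::finite pmf" and f :: "'a \<Rightarrow> 'b::finite"
  shows "(\<Sum>c\<in>UNIV. pmf (map_pmf f J) c * g c) = (\<Sum>a\<in>UNIV. pmf J a * (g (f a) :: real))"
proof -
  have "(\<Sum>c\<in>UNIV. pmf (map_pmf f J) c * g c) = measure_pmf.expectation (map_pmf f J) g"
    by (subst integral_measure_pmf_real[of UNIV]) (auto simp: mult.commute)
  also have "\<dots> = measure_pmf.expectation J (\<lambda>a. g (f a))" by simp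
  also have "\<dots> = (\<Sum>a\<in>UNIV. pmf J a * g (f a))"
    by (subst integral_measure_pmf_real[of UNIV]) (auto simp: mult.commute)
  finally show ?thesis .
qed

subsection \<open>Achievability\<close>

text \<open>
  Merges the codes that are good for each fixed accuracy into a single sequence of codes.
\<close>

lemma diagonal_selection:
  assumes base: "\<And>n. \<exists>c. P n 0 c"
    and ev: "\<And>m. eventually (\<lambda>n. \<exists>c. P n m c) sequentially"
    and mono: "\<And>n m c. P n (Suc m) c \<Longrightarrow> P n m c"
  shows "\<exists>c. (\<forall>n. P n 0 (c n)) \<and> (\<forall>m. eventually (\<lambda>n. P n m (c n)) sequentially)"
proof -
  have anti: "P n m c" if "P n m' c" "m \<le> m'" for n m m' c
    using that(2,1) by (induction rule: dec_induct) (auto intro: mono)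
  define K where "K = (\<lambda>n::nat. {m. m \<le> n \<and> (\<exists>c. P n m c)})"
  have K: "finite (K n)" "K n \<noteq> {}" for n
    using base[of n] by (auto simp: K_def intro: finite_subset[of _ "{..n}"])
  have "\<forall>n. \<exists>c. P n (Max (K n)) c"
    using Max_in[OF K] by (auto simp: K_def)
  then obtain c where c: "\<And>n. P n (Max (K n)) (c n)" by metis
  have "eventually (\<lambda>n. P n m (c n)) sequentially" for m
    using ev[of m] eventually_ge_at_top[of m]
  proof eventually_elim
    case (elim n)
    hence "m \<in> K n" by (simp add: K_def)
    hence "m \<le> Max (K n)" using K by (intro Max_ge) auto
    thus ?case using c anti by blast
  qed
  moreover have "P n 0 (c n)" for n using anti[OF c] by simp
  ultimately show ?thesis by blast
qed

text \<open>\<open>S\<close> is a codebook of word pairs. Injections number its pairs and its second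
  components by messages; the recoder recovers the pair and passes on only the number of its
  \<open>z\<close>-word.\<close>

lemma ex_cascade_code:
  assumes S: "S \<subseteq> blocks n \<times> blocks n" "finite S" "S \<noteq> {}"
    and card: "real (card S) \<le> 2 powr (real n * R1)" "real (card (snd ` S)) \<le> 2 powr (real n * R2)"
    and g: "\<And>xs. g xs \<in> S"
  shows "\<exists>enc rec decy decz. cascade_code R1 R2 n enc rec decy decz \<and>
     (\<forall>xs. decy (enc xs) = fst (g xs) \<and> decz (rec (enc xs)) = snd (g xs))"
proof -
  obtain s0 where s0: "s0 \<in> S" using S by blast
  have "card S \<le> card (messages n R1)" "card (snd ` S) \<le> card (messages n R2)"
    using card by (auto simp: messages_eq le_nat_iff le_floor_iff)
  then obtain f1 f2 where f1: "f1 ` S \<subseteq> messages n R1" "inj_on f1 S"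
    and f2: "f2 ` (snd ` S) \<subseteq> messages n R2" "inj_on f2 (snd ` S)"
    using card_le_inj[of S "messages n R1"] card_le_inj[of "snd ` S" "messages n R2"] S(2)
    by (auto simp: messages_eq)
  \<comment> \<open>Numbers outside the codebook decode to the fixed pair \<open>s0\<close>, so that
    the decoders stay within the blocks on all messages.\<close>
  define d1 where "d1 m = (if m \<in> f1 ` S then inv_into S f1 m else s0)" for m
  define d2 where "d2 m = (if m \<in> f2 ` (snd ` S) then inv_into (snd ` S) f2 m else snd s0)" for m
  have d1: "d1 m \<in> S" for m using s0 by (auto simp: d1_def inv_into_into)
  have d2: "d2 m \<in> snd ` S" for m
    unfolding d2_def using s0 by (auto intro: inv_into_into[of _ f2 "snd ` S"] simp del: image_eqI)
  have d1_f1: "d1 (f1 s) = s" if "s \<in> S" for s using that f1 by (simp add: d1_def)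
  have d2_f2: "d2 (f2 z) = z" if "z \<in> snd ` S" for z using that f2 by (simp add: d2_def)
  have "cascade_code R1 R2 n (\<lambda>xs. f1 (g xs)) (\<lambda>m. f2 (snd (d1 m))) (\<lambda>m. fst (d1 m)) d2"
    unfolding cascade_code_def
  proof (intro conjI funcsetI)
    show "f1 (g xs) \<in> messages n R1" for xs using f1 g by blast
    show "f2 (snd (d1 m)) \<in> messages n R2" for m using f2 d1 by blast
    show "fst (d1 m) \<in> blocks n" for m using d1[of m] S(1) by (auto simp: mem_Times_iff)
    show "d2 m \<in> blocks n" for m using d2[of m] S(1) by auto
  qed
  moreover have "fst (d1 (f1 (g xs))) = fst (g xs) \<and> d2 (f2 (snd (d1 (f1 (g xs))))) = snd (g xs)" for xs
    using g[of xs] by (simp add: d1_f1 d2_f2)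
  ultimately show ?thesis by blast
qed

text \<open>Concentration with a one-point side alphabet turns the conditional statement into one
  about i.i.d. words; the constant side sequence has frequency 1 as soon as
  \<open>n \<ge> 1\<close>.\<close>

lemma source_typical:
  fixes p0 :: "'x::finite pmf"
  assumes d: "d > 0"
  shows "(\<lambda>n. measure_pmf.prob (iid_pmf n p0) {xs. \<not> typical n (pmf p0) d xs}) \<longlonglongrightarrow> 0"
proof (rule tendsto_sandwich[of "\<lambda>_. 0" _ _ "\<lambda>n. 2 * CARD(unit \<times> 'x) * exp (- 2 * real n * d\<^sup>2)"])
  show "eventually (\<lambda>n. measure_pmf.prob (iid_pmf n p0) {xs. \<not> typical n (pmf p0) d xs}
    \<le> 2 * CARD(unit \<times> 'x) * exp (- 2 * real n * d\<^sup>2)) sequentially"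
    using eventually_ge_at_top[of 1]
  proof eventually_elim
    case (elim n)
    have "typical n (\<lambda>(a, b). empirical n (\<lambda>_. ()) a * pmf p0 b) d (\<lambda>k. ((), xs k))
       \<longleftrightarrow> typical n (pmf p0) d xs" for xs
      using elim by (auto simp: typical_def empirical_def)
    with prob_not_typical_le[OF d, of n "\<lambda>_. p0" "\<lambda>_. ()"] show ?case
      by (simp add: iid_pmf_def)
  qed
  show "(\<lambda>n. 2 * CARD(unit \<times> 'x) * exp (- 2 * real n * d\<^sup>2)) \<longlonglongrightarrow> 0"
    using d by real_asymp
qed auto

text \<open>Two-stage codebook: about exp(n D1) words for \<open>z\<close>, and for each of them
  about exp(n D2) words for \<open>y\<close>, where \<open>D1\<close> is I(X;Z) and
  \<open>D2\<close> is I(X;Y|Z). The second link carries only the \<open>z\<close>-word; the first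
  carries the pair, of total exponent \<open>D1 + D2\<close>, which is I(X;Y,Z).\<close>

lemma good_codes:
  fixes J :: "('x::finite \<times> 'y::finite \<times> 'z::finite) pmf"
  defines "Q \<equiv> map_pmf (\<lambda>(x, y, z). (x, z)) J"
  assumes R1: "info J < R1 * ln 2" and R2: "info Q < R2 * ln 2" and e: "e > 0"
  shows "eventually (\<lambda>n. \<exists>enc rec decy decz. cascade_code R1 R2 n enc rec decy decz \<and>
     measure_pmf.prob (iid_pmf n (map_pmf fst J))
       {xs. total_variation (joint_type n xs (decy (enc xs)) (decz (rec (enc xs)))) (pmf J) > e} \<le> e)
     sequentially"
proof -
  let ?p0 = "map_pmf fst J" and ?pz = "map_pmf snd Q"
  have p0: "map_pmf fst Q = ?p0" by (simp add: Q_def pmf.map_comp o_def case_prod_unfold)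
  define QY where "QY = map_pmf (\<lambda>(x, y, z). ((x, z), y)) J"
  define QZ where "QZ = map_pmf (\<lambda>(x, y, z). (z, y)) J"
  have fstQY: "map_pmf fst QY = Q" by (simp add: Q_def QY_def pmf.map_comp o_def case_prod_unfold)
  have fstQZ: "map_pmf fst QZ = ?pz" by (simp add: Q_def QZ_def pmf.map_comp o_def case_prod_unfold)
  have fstQ: "fst ` set_pmf QY = set_pmf Q" by (simp flip: fstQY)
  \<comment> \<open>The \<open>z\<close>-stage has a side letter of type \<open>unit\<close>, which
    makes it an instance of the same covering lemma as the \<open>y\<close>-stage.\<close>
  define P1 where "P1 = (\<lambda>(x, u::unit). pmf ?p0 x)"
  define V1 where "V1 = (\<lambda>(x, u::unit). cond_kernel Q x)"
  define W1 where "W1 = (\<lambda>u::unit. ?pz)"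
  define W2 where "W2 = cond_kernel QZ"
  \<comment> \<open>Off the support of \<open>Q\<close> the kernel is set to \<open>W2 z\<close>, so
    that absolute continuity with respect to \<open>W2\<close> holds for all pairs.\<close>
  define V2 where "V2 = (\<lambda>(x, z). if (x, z) \<in> set_pmf Q then cond_kernel QY (x, z) else W2 z)"
  define D1 where "D1 = relative_entropy P1 V1 (\<lambda>(x, u). W1 u)"
  define D2 where "D2 = relative_entropy (pmf Q) V2 (\<lambda>(x, z). W2 z)"
  have ac1: "set_pmf (V1 (x, u)) \<subseteq> set_pmf (W1 u)" for x u
    unfolding V1_def W1_def prod.case by (rule set_cond_kernel_subset)
  have ac2: "set_pmf (V2 (x, z)) \<subseteq> set_pmf (W2 z)" for x z
  proof (cases "(x, z) \<in> set_pmf Q")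
    case True
    hence 1: "(x, z) \<in> fst ` set_pmf QY" by (simp only: fstQ)
    hence 2: "z \<in> fst ` set_pmf QZ" by (force simp: QY_def QZ_def)
    have "set_pmf (V2 (x, z)) = {y. ((x, z), y) \<in> set_pmf QY}"
      using True by (simp add: V2_def set_cond_kernel[OF 1])
    moreover have "set_pmf (W2 z) = {y. (z, y) \<in> set_pmf QZ}"
      unfolding W2_def by (rule set_cond_kernel[OF 2])
    moreover have "set_pmf QZ = (\<lambda>((x, z), y). (z, y)) ` set_pmf QY"
      by (simp add: QY_def QZ_def image_image case_prod_unfold)
    ultimately show ?thesis by (auto intro: rev_image_eqI)
  qed (simp add: V2_def)
  have PV1: "(\<lambda>(a, b). P1 a * pmf (V1 a) b) ((x, u), z) = pmf Q (x, z)" for x u z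
    using pmf_cond_kernel[of Q x z] by (simp add: P1_def V1_def p0)
  have PV2: "pmf Q (x, z) * pmf (V2 (x, z)) y = pmf QY ((x, z), y)" for x y z
    using pmf_cond_kernel[of QY "(x, z)" y]
    by (cases "(x, z) \<in> set_pmf Q") (auto simp: V2_def fstQY set_pmf_iff)
  have QY: "pmf QY ((x, z), y) = pmf J (x, y, z)" for x y z
    unfolding QY_def
    by (subst pmf_map_inj'[of "\<lambda>(x, y, z). ((x, z), y)" J "(x, y, z)", simplified, symmetric])
       (auto simp: inj_def)
  have D1: "D1 = info Q"
  proof -
    have "D1 = (\<Sum>(x, z)\<in>UNIV. P1 (x, ()) * pmf (V1 (x, ())) z * ln (pmf (V1 (x, ())) z / pmf (W1 ()) z))"
      unfolding D1_def relative_entropy_def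
      by (rule sum.reindex_bij_witness[of _ "\<lambda>(x, z). ((x, ()), z)" "\<lambda>((x, _), z). (x, z)"]) auto
    also have "\<dots> = info Q"
      unfolding info_def
    proof (intro sum.cong refl, clarify)
      fix x z
      have eq: "pmf ?p0 x * pmf (V1 (x, ())) z = pmf Q (x, z)" using PV1[of x "()" z] by (simp add: P1_def)
      show "P1 (x, ()) * pmf (V1 (x, ())) z * ln (pmf (V1 (x, ())) z / pmf (W1 ()) z)
        = pmf Q (x, z) * ln (pmf Q (x, z) / (pmf (map_pmf fst Q) x * pmf ?pz z))"
        by (cases "pmf ?p0 x = 0") (auto simp: P1_def W1_def p0 eq[symmetric])
    qed
    finally show ?thesis .
  qed
  \<comment> \<open>Chain rule. On the support of \<open>J\<close>, p(x,z) / (p(x) p(z)) times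
    p(y|x,z) / p(y|z) equals p(x,y,z) / (p(x) p(y,z)).\<close>
  have D2: "info J = D1 + D2"
  proof -
    have "D2 = (\<Sum>c\<in>UNIV. pmf QY c * ln (pmf (V2 (fst c)) (snd c) / pmf (W2 (snd (fst c))) (snd c)))"
      unfolding D2_def relative_entropy_def by (intro sum.cong refl) (auto simp: PV2)
    also have "\<dots> = (\<Sum>(x, y, z)\<in>UNIV. pmf J (x, y, z) * ln (pmf (V2 (x, z)) y / pmf (W2 z) y))"
      unfolding QY_def by (subst sum_pmf_map) (simp add: case_prod_beta)
    finally have D2': "D2 = (\<Sum>(x, y, z)\<in>UNIV. pmf J (x, y, z) * ln (pmf (V2 (x, z)) y / pmf (W2 z) y))" .
    have "info Q = (\<Sum>c\<in>UNIV. pmf Q c * ln (pmf Q c / (pmf ?p0 (fst c) * pmf ?pz (snd c))))"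
      by (simp add: info_def p0 case_prod_beta)
    also have "\<dots> = (\<Sum>(x, y, z)\<in>UNIV. pmf J (x, y, z) * ln (pmf Q (x, z) / (pmf ?p0 x * pmf ?pz z)))"
      by (subst (1) Q_def, subst sum_pmf_map) (simp add: case_prod_beta)
    finally have "D1 + D2 = (\<Sum>(x, y, z)\<in>UNIV. pmf J (x, y, z) * ln (pmf Q (x, z) / (pmf ?p0 x * pmf ?pz z))
       + pmf J (x, y, z) * ln (pmf (V2 (x, z)) y / pmf (W2 z) y))"
      by (simp add: D1 D2' case_prod_beta sum.distrib)
    also have "\<dots> = info J"
      unfolding info_def
    proof (intro sum.cong refl, clarify)
      fix x y z
      have QZ': "pmf QZ (z, y) = pmf (map_pmf snd J) (y, z)"
      proof -
        have "QZ = map_pmf (\<lambda>(y, z). (z, y)) (map_pmf snd J)"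
          by (simp add: QZ_def pmf.map_comp o_def case_prod_unfold)
        thus ?thesis using pmf_map_inj'[of "\<lambda>(y, z). (z, y)" "map_pmf snd J" "(y, z)"]
          by (auto simp: inj_def)
      qed
      show "pmf J (x, y, z) * ln (pmf Q (x, z) / (pmf ?p0 x * pmf ?pz z))
          + pmf J (x, y, z) * ln (pmf (V2 (x, z)) y / pmf (W2 z) y)
        = pmf J (x, y, z) * ln (pmf J (x, y, z) / (pmf ?p0 x * pmf (map_pmf snd J) (y, z)))"
      proof (cases "pmf J (x, y, z) = 0")
        case False
        hence J: "pmf J (x, y, z) > 0" by (simp add: less_le)
        have "pmf Q (x, z) > 0" "pmf ?p0 x > 0" "pmf QZ (z, y) > 0"
          using J pmf_le_pmf_map[of J "(x, y, z)" "\<lambda>(x, y, z). (x, z)"]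
            pmf_le_pmf_map[of J "(x, y, z)" fst] pmf_le_pmf_map[of J "(x, y, z)" "\<lambda>(x, y, z). (z, y)"]
          by (auto simp: Q_def QZ_def)
        moreover from this have "pmf ?pz z > 0"
          using pmf_le_pmf_map[of Q "(x, z)" snd] by auto
        moreover have "pmf (V2 (x, z)) y = pmf J (x, y, z) / pmf Q (x, z)"
          using PV2[of x z y] \<open>pmf Q (x, z) > 0\<close> by (simp add: QY field_simps)
        moreover have "pmf (W2 z) y = pmf QZ (z, y) / pmf ?pz z"
          using pmf_cond_kernel[of QZ z y] \<open>pmf ?pz z > 0\<close> by (simp add: W2_def fstQZ field_simps)
        ultimately show ?thesis using J
          by (simp add: ln_div ln_mult QZ' distrib_left[symmetric])
      qed simp
    qed
    finally show ?thesis by simp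
  qed
  have D1_nn: "D1 \<ge> 0"
    unfolding D1_def by (rule relative_entropy_nonneg) (auto simp: P1_def dest!: subsetD[OF ac1])
  have D2_nn: "D2 \<ge> 0"
    unfolding D2_def by (rule relative_entropy_nonneg) (auto dest!: subsetD[OF ac2])
  note D_nn = D1_nn D2_nn
  \<comment> \<open>A third of the smaller slack, in nats, of the two rates: \<open>R1\<close> has
    to absorb \<open>\<eta>\<close> twice, once per stage, and \<open>R2\<close> once.\<close>
  define \<eta> where "\<eta> = min (R1 * ln 2 - info J) (R2 * ln 2 - info Q) / 3"
  have \<eta>: "\<eta> > 0" "D1 + \<eta> + (D2 + \<eta>) \<le> R1 * ln 2" "D1 + \<eta> \<le> R2 * ln 2"
    using R1 R2 by (auto simp: \<eta>_def D1 D2 min_def field_simps)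
  \<comment> \<open>Passing from letterwise accuracy to total variation costs a factor of the
    alphabet size.\<close>
  define e' where "e' = e / real CARD('x \<times> 'y \<times> 'z)"
  have e': "e' > 0" using e by (simp add: e'_def)
  \<comment> \<open>Tolerances are chosen backwards: accuracy \<open>e'\<close> for the triples
    demands \<open>d2\<close> for the pairs \<open>(x, z)\<close>, which is the target of the first
    stage and in turn demands \<open>d1\<close> for the source.\<close>
  obtain d2 where d2: "d2 > 0" and cov2: "eventually (\<lambda>n. \<forall>cs. \<exists>B\<subseteq>blocks n. finite B \<and> real (card B) \<le> exp (real n * (D2 + \<eta>)) \<and>
     (\<forall>xs\<in>blocks n. typical n (pmf Q) d2 (\<lambda>k. (xs k, cs k)) \<longrightarrow>
        (\<exists>ys\<in>B. typical n (\<lambda>(a, b). pmf Q a * pmf (V2 a) b) e' (\<lambda>k. ((xs k, cs k), ys k))))) sequentially"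
    using conditional_covering[of V2 W2 "pmf Q" "D2 + \<eta>" e', OF ac2] \<eta> D_nn e' by (auto simp: D2_def)
  obtain d1 where d1: "d1 > 0" and cov1: "eventually (\<lambda>n. \<forall>cs. \<exists>B\<subseteq>blocks n. finite B \<and> real (card B) \<le> exp (real n * (D1 + \<eta>)) \<and>
     (\<forall>xs\<in>blocks n. typical n P1 d1 (\<lambda>k. (xs k, cs k)) \<longrightarrow>
        (\<exists>ys\<in>B. typical n (\<lambda>(a, b). P1 a * pmf (V1 a) b) d2 (\<lambda>k. ((xs k, cs k), ys k))))) sequentially"
    using conditional_covering[of V1 W1 P1 "D1 + \<eta>" d2, OF ac1] \<eta> D_nn d2 by (auto simp: D1_def)
  have src: "eventually (\<lambda>n. measure_pmf.prob (iid_pmf n ?p0) {xs. \<not> typical n (pmf ?p0) d1 xs} < e) sequentially"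
    by (rule order_tendstoD(2)[OF source_typical[OF d1] e])
  from cov1 cov2 src show ?thesis
  proof eventually_elim
    case (elim n)
    obtain Bz where Bz: "Bz \<subseteq> blocks n" "finite Bz" "real (card Bz) \<le> exp (real n * (D1 + \<eta>))"
      "\<And>xs. xs \<in> blocks n \<Longrightarrow> typical n P1 d1 (\<lambda>k. (xs k, ())) \<Longrightarrow>
        \<exists>zs\<in>Bz. typical n (\<lambda>(a, b). P1 a * pmf (V1 a) b) d2 (\<lambda>k. ((xs k, ()), zs k))"
      using elim(1)[rule_format, of "\<lambda>_. ()"] by auto
    from choice[OF elim(2)] obtain By where By: "\<forall>zs. By zs \<subseteq> blocks n \<and> finite (By zs) \<and>
      real (card (By zs)) \<le> exp (real n * (D2 + \<eta>)) \<and>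
      (\<forall>xs\<in>blocks n. typical n (pmf Q) d2 (\<lambda>k. (xs k, zs k)) \<longrightarrow>
        (\<exists>ys\<in>By zs. typical n (\<lambda>(a, b). pmf Q a * pmf (V2 a) b) e' (\<lambda>k. ((xs k, zs k), ys k))))"
      by (rule exE)
    have By_fin: "By zs \<subseteq> blocks n" "finite (By zs)" "real (card (By zs)) \<le> exp (real n * (D2 + \<eta>))" for zs
      using By by simp_all
    have By_cov: "\<exists>ys\<in>By zs. typical n (\<lambda>(a, b). pmf Q a * pmf (V2 a) b) e' (\<lambda>k. ((xs k, zs k), ys k))"
      if "xs \<in> blocks n" "typical n (pmf Q) d2 (\<lambda>k. (xs k, zs k))" for xs zs
      using By that by simp
    \<comment> \<open>Every codebook pair has its \<open>z\<close>-word in \<open>Bz\<close>, which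
      bounds the second rate; the size of the whole union bounds the first.\<close>
    define S where "S = (\<lambda>(zs, ys). (ys, zs)) ` (SIGMA zs:Bz. By zs)"
    define good where "good xs s \<longleftrightarrow> typical n (pmf J) e' (\<lambda>k. (xs k, fst s k, snd s k))"
      for xs :: "nat \<Rightarrow> 'x" and s :: "(nat \<Rightarrow> 'y) \<times> (nat \<Rightarrow> 'z)"
    have good: "\<exists>s\<in>S. good xs s" if xs: "xs \<in> blocks n" "typical n (pmf ?p0) d1 xs" for xs
    proof -
      have "typical n P1 d1 (\<lambda>k. (xs k, ()))"
        using xs(2) by (auto simp: typical_def empirical_def P1_def)
      then obtain zs where zs: "zs \<in> Bz" "typical n (\<lambda>(a, b). P1 a * pmf (V1 a) b) d2 (\<lambda>k. ((xs k, ()), zs k))"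
        using Bz(4)[OF xs(1)] by blast
      have "typical n (pmf Q) d2 (\<lambda>k. (xs k, zs k))"
        unfolding typical_def
      proof
        fix a :: "'x \<times> 'z"
        show "\<bar>empirical n (\<lambda>k. (xs k, zs k)) a - pmf Q a\<bar> \<le> d2"
          using zs(2)[unfolded typical_def, rule_format, of "((fst a, ()), snd a)"] PV1[of "fst a" "()" "snd a"]
          by (cases a) (simp add: empirical_def)
      qed
      then obtain ys where ys: "ys \<in> By zs"
        "typical n (\<lambda>(a, b). pmf Q a * pmf (V2 a) b) e' (\<lambda>k. ((xs k, zs k), ys k))"
        using By_cov[OF xs(1)] by blast
      have "good xs (ys, zs)"
        unfolding good_def typical_def
      proof
        fix a :: "'x \<times> 'y \<times> 'z"
        obtain x y z where a: "a = (x, y, z)" by (cases a)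
        show "\<bar>empirical n (\<lambda>k. (xs k, fst (ys, zs) k, snd (ys, zs) k)) a - pmf J a\<bar> \<le> e'"
          using ys(2)[unfolded typical_def, rule_format, of "((x, z), y)"]
          by (simp add: a empirical_def PV2 QY conj_ac)
      qed
      moreover have "(ys, zs) \<in> S" using zs ys by (force simp: S_def)
      ultimately show ?thesis by blast
    qed
    \<comment> \<open>The decoders need some codeword even if \<open>S\<close> is empty; the
      constantly \<open>undefined\<close> word lies in \<open>blocks n\<close>.\<close>
    define S' where "S' = (if S = {} then {(\<lambda>_. undefined, \<lambda>_. undefined)} else S)"
    define g where "g xs = (if \<exists>s\<in>S. good xs s then SOME s. s \<in> S \<and> good xs s else SOME s. s \<in> S')" for xs
    have g_good: "g xs \<in> S \<and> good xs (g xs)" if "\<exists>s\<in>S. good xs s" for xs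
      using that someI_ex[of "\<lambda>s. s \<in> S \<and> good xs s"] by (auto simp: g_def)
    have S'_ne: "S' \<noteq> {}" by (simp add: S'_def)
    have g_S': "g xs \<in> S'" for xs
    proof (cases "\<exists>s\<in>S. good xs s")
      case True
      with g_good[OF True] show ?thesis by (auto simp: S'_def)
    next
      case False
      thus ?thesis using S'_ne by (simp add: g_def some_in_eq)
    qed
    have fin: "finite S" using Bz(2) By_fin(2) by (auto simp: S_def)
    have "card S \<le> card (SIGMA zs:Bz. By zs)"
      unfolding S_def using Bz(2) By_fin(2) by (intro card_image_le) auto
    also have "\<dots> = (\<Sum>zs\<in>Bz. card (By zs))"
      using Bz(2) By_fin(2) by simp
    finally have "real (card S) \<le> (\<Sum>zs\<in>Bz. real (card (By zs)))"
      by (simp flip: of_nat_sum)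
    also have "\<dots> \<le> real (card Bz) * exp (real n * (D2 + \<eta>))"
      using By_fin(3) by (intro sum_bounded_above) auto
    also have "\<dots> \<le> exp (real n * (D1 + \<eta>)) * exp (real n * (D2 + \<eta>))"
      using Bz(3) by (intro mult_right_mono) auto
    also have "\<dots> = exp (real n * (D1 + \<eta> + (D2 + \<eta>)))"
      by (simp add: exp_add[symmetric] distrib_left)
    also have "\<dots> \<le> 2 powr (real n * R1)"
      unfolding powr_eq_exp_rate exp_le_cancel_iff by (rule mult_left_mono[OF \<eta>(2)]) simp
    finally have card1: "real (card S) \<le> 2 powr (real n * R1)" .
    have "card (snd ` S) \<le> card Bz"
      using Bz(2) by (intro card_mono) (auto simp: S_def)
    hence "real (card (snd ` S)) \<le> exp (real n * (D1 + \<eta>))" using Bz(3) by linarith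
    also have "\<dots> \<le> 2 powr (real n * R2)"
      unfolding powr_eq_exp_rate exp_le_cancel_iff by (rule mult_left_mono[OF \<eta>(3)]) simp
    finally have card2: "real (card (snd ` S)) \<le> 2 powr (real n * R2)" .
    have one: "1 \<le> 2 powr (real n * R1)" "1 \<le> 2 powr (real n * R2)"
      using \<eta> D_nn by (auto simp: powr_eq_exp_rate)
    have "\<exists>enc rec decy decz. cascade_code R1 R2 n enc rec decy decz \<and>
       (\<forall>xs. decy (enc xs) = fst (g xs) \<and> decz (rec (enc xs)) = snd (g xs))"
    proof (rule ex_cascade_code)
      show "S' \<subseteq> blocks n \<times> blocks n"
      proof (cases "S = {}")
        case True
        thus ?thesis by (simp add: S'_def blocks_def PiE_def extensional_def)
      next
        case False
        thus ?thesis using Bz(1) by (auto simp: S'_def S_def dest!: subsetD[OF By_fin(1)])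
      qed
    qed (use fin card1 card2 one S'_ne g_S' in \<open>auto simp: S'_def\<close>)
    then obtain enc rec decy decz where code: "cascade_code R1 R2 n enc rec decy decz"
      "\<And>xs. decy (enc xs) = fst (g xs)" "\<And>xs. decz (rec (enc xs)) = snd (g xs)"
      by blast
    have "measure_pmf.prob (iid_pmf n ?p0)
        {xs. total_variation (joint_type n xs (decy (enc xs)) (decz (rec (enc xs)))) (pmf J) > e}
      = measure_pmf.prob (iid_pmf n ?p0)
        ({xs. total_variation (joint_type n xs (decy (enc xs)) (decz (rec (enc xs)))) (pmf J) > e} \<inter> blocks n)"
      unfolding iid_pmf_def by (rule prob_Pi_Int_blocks[symmetric])
    \<comment> \<open>An error forces the source word itself to be atypical, since every typical one
      has a good codebook pair.\<close>
    also have "\<dots> \<le> measure_pmf.prob (iid_pmf n ?p0) {xs. \<not> typical n (pmf ?p0) d1 xs}"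
    proof (intro measure_pmf.finite_measure_mono subsetI CollectI notI)
      fix xs assume xs: "xs \<in> {xs. total_variation (joint_type n xs (decy (enc xs)) (decz (rec (enc xs)))) (pmf J) > e} \<inter> blocks n"
        and tp: "typical n (pmf ?p0) d1 xs"
      have "good xs (g xs)" using g_good good tp xs by blast
      hence "total_variation (joint_type n xs (fst (g xs)) (snd (g xs))) (pmf J) \<le> real CARD('x \<times> 'y \<times> 'z) * e'"
        unfolding joint_type_eq_empirical good_def by (rule total_variation_le_if_typical)
      also have "\<dots> = e" by (simp add: e'_def)
      finally show False using xs by (simp add: code)
    qed auto
    finally show ?case using elim(3) code(1) by (meson less_imp_le order_trans)
  qed
qed

text \<open>Rates strictly above the bounds give codes of each accuracy
  \<open>1 / real (Suc m)\<close> for all large \<open>n\<close>; the diagonal choice lets the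
  accuracy tend to 0 along one sequence.\<close>

lemma achievable_if_rates:
  fixes w :: "'x::finite \<Rightarrow> ('y::finite \<times> 'z::finite) pmf"
  assumes R1: "info (graph_pmf p0 w) < R1 * ln 2"
    and R2: "info (graph_pmf p0 (\<lambda>x. map_pmf snd (w x))) < R2 * ln 2"
    and nn: "0 \<le> R1" "0 \<le> R2"
  shows "achievable p0 w R1 R2"
proof -
  let ?J = "joint_pmf p0 w"
  define TV where "TV n c xs = (case c of (enc, rec, decy, decz) \<Rightarrow>
      total_variation (joint_type n xs (decy (enc xs)) (decz (rec (enc xs)))) (pmf ?J))"
    for n and c :: "((nat \<Rightarrow> 'x) \<Rightarrow> nat) \<times> (nat \<Rightarrow> nat) \<times> (nat \<Rightarrow> nat \<Rightarrow> 'y) \<times> (nat \<Rightarrow> nat \<Rightarrow> 'z)" and xs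
  define code where "code n c = (case c of (enc, rec, decy, decz) \<Rightarrow> cascade_code R1 R2 n enc rec decy decz)"
    for n and c :: "((nat \<Rightarrow> 'x) \<Rightarrow> nat) \<times> (nat \<Rightarrow> nat) \<times> (nat \<Rightarrow> nat \<Rightarrow> 'y) \<times> (nat \<Rightarrow> nat \<Rightarrow> 'z)"
  define good where "good n m c \<longleftrightarrow> code n c \<and>
      measure_pmf.prob (iid_pmf n p0) {xs. TV n c xs > 1 / real (Suc m)} \<le> 1 / real (Suc m)" for n m c
  have Q: "map_pmf (\<lambda>(x, y, z). (x, z)) ?J = graph_pmf p0 (\<lambda>x. map_pmf snd (w x))"
    using map_graph_pmf[of snd p0 w] by (simp add: joint_pmf_eq_graph_pmf case_prod_unfold)
  have p0: "map_pmf fst ?J = p0"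
    by (simp add: joint_pmf_eq_graph_pmf map_fst_graph_pmf)
  have "\<exists>c. (\<forall>n. good n 0 (c n)) \<and> (\<forall>m. eventually (\<lambda>n. good n m (c n)) sequentially)"
  proof (rule diagonal_selection)
    \<comment> \<open>At index 0 the bound on the probability is 1, so any code will do. A constant
      one exists for every \<open>n\<close>, because nonnegative rates allow at least one
      message.\<close>
    fix n
    define g :: "(nat \<Rightarrow> 'x) \<Rightarrow> (nat \<Rightarrow> 'y) \<times> (nat \<Rightarrow> 'z)"
      where "g = (\<lambda>_. (\<lambda>_. undefined, \<lambda>_. undefined))"
    have "range g \<subseteq> blocks n \<times> blocks n" "finite (range g)" "card (range g) = 1" "card (snd ` range g) = 1"
      by (auto simp: g_def blocks_def image_constant_conv)
    moreover have "1 \<le> 2 powr (real n * R1)" "1 \<le> 2 powr (real n * R2)"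
      using nn by (simp_all add: ge_one_powr_ge_zero)
    ultimately have "\<exists>enc rec decy decz. cascade_code R1 R2 n enc rec decy decz \<and>
       (\<forall>xs. decy (enc xs) = fst (g xs) \<and> decz (rec (enc xs)) = snd (g xs))"
      by (intro ex_cascade_code) auto
    then obtain enc :: "(nat \<Rightarrow> 'x) \<Rightarrow> nat" and rec and decy :: "nat \<Rightarrow> nat \<Rightarrow> 'y" and decz :: "nat \<Rightarrow> nat \<Rightarrow> 'z"
      where "cascade_code R1 R2 n enc rec decy decz" by blast
    thus "\<exists>c. good n 0 c"
      by (intro exI[of _ "(enc, rec, decy, decz)"]) (simp add: good_def code_def)
  next
    fix m
    have "info ?J < R1 * ln 2" "info (map_pmf (\<lambda>(x, y, z). (x, z)) ?J) < R2 * ln 2"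
      using R1 R2 by (simp_all only: Q joint_pmf_eq_graph_pmf[symmetric])
    from good_codes[OF this, of "1 / real (Suc m)"]
    have "eventually (\<lambda>n. \<exists>enc rec decy decz. good n m (enc, rec, decy, decz)) sequentially"
      by (simp add: good_def code_def TV_def p0)
    thus "eventually (\<lambda>n. \<exists>c. good n m c) sequentially"
      by eventually_elim blast
  next
    fix n m c assume good: "good n (Suc m) c"
    have le: "1 / real (Suc (Suc m)) \<le> 1 / real (Suc m)" by (simp add: frac_le)
    have "measure_pmf.prob (iid_pmf n p0) {xs. TV n c xs > 1 / real (Suc m)}
       \<le> measure_pmf.prob (iid_pmf n p0) {xs. TV n c xs > 1 / real (Suc (Suc m))}"
      using le by (intro measure_pmf.finite_measure_mono) auto
    also have "\<dots> \<le> 1 / real (Suc m)" using good le unfolding good_def by linarith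
    finally show "good n m c" using good by (simp add: good_def)
  qed
  then obtain c where c: "\<And>n. good n 0 (c n)" "\<And>m. eventually (\<lambda>n. good n m (c n)) sequentially"
    by blast
  have lim: "(\<lambda>n. measure_pmf.prob (iid_pmf n p0) {xs. TV n (c n) xs > e}) \<longlonglongrightarrow> 0" if e: "e > 0" for e
  proof (rule order_tendstoI)
    fix d :: real assume d: "0 < d"
    \<comment> \<open>One index serves both purposes: accuracy below \<open>e\<close> for the event
      and below \<open>d\<close> for its probability.\<close>
    obtain m where m: "1 / real (Suc m) < min e d"
      using nat_approx_posE[of "min e d"] e d by auto
    show "eventually (\<lambda>n. measure_pmf.prob (iid_pmf n p0) {xs. TV n (c n) xs > e} < d) sequentially"
      using c(2)[of m]
    proof eventually_elim
      case (elim n)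
      have "measure_pmf.prob (iid_pmf n p0) {xs. TV n (c n) xs > e}
         \<le> measure_pmf.prob (iid_pmf n p0) {xs. TV n (c n) xs > 1 / real (Suc m)}"
        using m by (intro measure_pmf.finite_measure_mono) auto
      also have "\<dots> \<le> 1 / real (Suc m)" using elim by (simp add: good_def)
      also have "\<dots> < d" using m by simp
      finally show ?case .
    qed
  next
    fix d :: real assume "d < 0"
    thus "eventually (\<lambda>n. d < measure_pmf.prob (iid_pmf n p0) {xs. TV n (c n) xs > e}) sequentially"
      by (intro always_eventually allI) (auto intro: less_le_trans[OF _ measure_nonneg])
  qed
  show ?thesis
    unfolding achievable_def
  proof (intro exI conjI allI impI)
    show "cascade_code R1 R2 n ((\<lambda>n. fst (c n)) n) ((\<lambda>n. fst (snd (c n))) n)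
        ((\<lambda>n. fst (snd (snd (c n)))) n) ((\<lambda>n. snd (snd (snd (c n)))) n)" for n
      using c(1)[of n] by (simp add: good_def code_def case_prod_unfold)
    show "(\<lambda>n. measure_pmf.prob (iid_pmf n p0)
            {xs. e < total_variation
                   (joint_type n xs ((\<lambda>n. fst (snd (snd (c n)))) n ((\<lambda>n. fst (c n)) n xs))
                     ((\<lambda>n. snd (snd (snd (c n)))) n ((\<lambda>n. fst (snd (c n))) n ((\<lambda>n. fst (c n)) n xs))))
                   (pmf ?J)}) \<longlonglongrightarrow> 0" if "0 < e" for e
      using lim[OF that] by (simp add: TV_def case_prod_unfold)
  qed
qed

section \<open>Nonnegativity of mutual information and the two inclusions for the region\<close>

text \<open>Mutual information is the relative entropy of the channel to its output distribution.
  Inputs of probability 0 are given the output distribution itself, which makes absolute continuity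
  hold for all inputs.\<close>

lemma info_nonneg:
  fixes p :: "'x::finite pmf" and v :: "'x \<Rightarrow> 'b::finite pmf"
  shows "info (graph_pmf p v) \<ge> 0"
proof -
  let ?r = "map_pmf snd (graph_pmf p v)"
  let ?v = "\<lambda>x. if x \<in> set_pmf p then v x else ?r"
  have "info (graph_pmf p v) = relative_entropy (pmf p) ?v (\<lambda>_. ?r)"
    unfolding info_def relative_entropy_def
    by (intro sum.cong refl) (auto simp: pmf_graph_pmf map_fst_graph_pmf set_pmf_iff)
  also have "\<dots> \<ge> 0"
  proof (rule relative_entropy_nonneg)
    show "set_pmf (?v x) \<subseteq> set_pmf ?r" for x
      by (auto simp: graph_pmf_def image_UN image_image)
  qed simp
  finally show ?thesis .
qed

theorem theorem5:
  fixes p0 :: "'x::finite pmf"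
  shows "(coordination_capacity_region p0 ::
            (real \<times> real \<times> ('x \<Rightarrow> 'y::finite \<times> 'z::finite \<Rightarrow> real)) set) =
    {(R1, R2, \<lambda>x. pmf (w x)) | R1 R2 w.
       R1 \<ge> mutual_info (joint_pmf p0 w) (\<lambda>(x, y, z). x) (\<lambda>(x, y, z). (y, z)) \<and>
       R2 \<ge> mutual_info (joint_pmf p0 w) (\<lambda>(x, y, z). x) (\<lambda>(x, y, z). z)}"
    (is "_ = ?S")
proof -
  let ?A = "{(R1, R2, \<lambda>x. pmf (w x)) | R1 R2 (w :: 'x \<Rightarrow> ('y \<times> 'z) pmf).
       0 \<le> R1 \<and> 0 \<le> R2 \<and> achievable p0 w R1 R2}"
  let ?I1 = "\<lambda>w :: 'x \<Rightarrow> ('y \<times> 'z) pmf. info (graph_pmf p0 w)"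
  let ?I2 = "\<lambda>w :: 'x \<Rightarrow> ('y \<times> 'z) pmf. info (graph_pmf p0 (\<lambda>x. map_pmf snd (w x)))"
  have S: "?S = {(R1, R2, \<lambda>x. pmf (w x)) | R1 R2 w. ?I1 w \<le> R1 * ln 2 \<and> ?I2 w \<le> R2 * ln 2}"
  proof -
    have "x / ln 2 \<le> R \<longleftrightarrow> x \<le> R * ln 2" for x R :: real
      by (simp add: pos_divide_le_eq)
    thus ?thesis by (simp only: info_rates)
  qed
  have "closure ?A \<subseteq> ?S"
  proof (rule closure_minimal)
    show "closed ?S" unfolding S by (rule closed_rate_region)
    show "?A \<subseteq> ?S" unfolding S using achievable_imp_rates by blast
  qed
  moreover have "?S \<subseteq> closure ?A"
  proof
    fix t assume "t \<in> ?S"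
    then obtain R1 R2 w where t: "t = (R1, R2, \<lambda>x. pmf (w x))"
      and R: "?I1 w \<le> R1 * ln 2" "?I2 w \<le> R2 * ln 2"
      unfolding S by blast
    \<comment> \<open>The capacity region asks for nonnegative rates; here they follow from the
      nonnegativity of mutual information.\<close>
    have nn: "0 \<le> R1" "0 \<le> R2"
      using order_trans[OF info_nonneg R(1)] order_trans[OF info_nonneg R(2)]
      by (simp_all add: zero_le_mult_iff)
    \<comment> \<open>Raising both rates by \<open>1 / (k + 1)\<close> makes the inequalities
      strict, hence the points achievable; they converge to \<open>t\<close>.\<close>
    define s where "s = (\<lambda>k. (R1 + inverse (real (Suc k)), R2 + inverse (real (Suc k)), \<lambda>x. pmf (w x)))"
    have "s k \<in> ?A" for k
    proof -
      have "R * ln 2 < (R + inverse (real (Suc k))) * ln 2" for R :: real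
        by (intro mult_strict_right_mono) auto
      hence "achievable p0 w (R1 + inverse (real (Suc k))) (R2 + inverse (real (Suc k)))"
        using R nn by (intro achievable_if_rates) (auto intro: le_less_trans)
      moreover have "0 \<le> R1 + inverse (real (Suc k))" "0 \<le> R2 + inverse (real (Suc k))"
        using nn by simp_all
      ultimately show ?thesis unfolding s_def by blast
    qed
    moreover have "s \<longlonglongrightarrow> (R1 + 0, R2 + 0, \<lambda>x. pmf (w x))"
      unfolding s_def
      by (intro tendsto_Pair tendsto_add tendsto_const LIMSEQ_inverse_real_of_nat)
    ultimately show "t \<in> closure ?A"
      unfolding closure_sequential t by auto
  qed
  ultimately show ?thesis unfolding coordination_capacity_region_def by blast
qed

end
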